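(* Let $(\Omega,\mathcal F,(\mathcal F_t)_{t=0}^T,P)$ be a complete filtered probability space, let $n=n_0+\cdots+n_T$, and let $h:\mathbb R^n\times\Omega\to\overline{\mathbb R}$ be an $\mathcal F$-normal integrand such that $h\ge m$ for some $m\in L^1(\Omega,\mathcal F,P)$. Let $\mathcal N$ and the functions $h_t$ be as defined in the context. If $$\{x\in\mathcal N\mid h^\infty(x)\le0\ \text{a.s.}\}=\{0\},$$ then, for each $t=0,\ldots,T$, whenever $h_t$ is well-defined, $h_t^\infty(0,x_t)>0$ for all $x_t\in\mathbb R^{n_t}\setminus\{0\}$ ($P$-almost surely).
   Context: A $\mathcal G$-normal integrand on $\mathbb R^k\times\Omega$ (for a $\sigma$-algebra $\mathcal G\subseteq\mathcal F$) is an extended real-valued $\mathcal B(\mathbb R^k)\otimes\mathcal G$-measurable function $g$ such that $g(\cdot,\omega)$ is lower semicontinuous for every $\omega$. Properties of normal integrands (positivity, inequalities, etc.) are understood $P$-almost surely, i.e. they hold for $g(\cdot,\omega)$ for all $\omega$ in a set of probability one. $\mathcal N:=\{(x_t)_{t=0}^T \mid x_t\in L^0(\Omega,\mathcal F_t,P;\mathbb R^{n_t})\}$ for given integers $n_t$ with $n_0+\cdots+n_T=n$; random variables that agree almost surely are identified. Notation: $x^t=(x_0,\ldots,x_t)$ (with $x^{-1}$ void). Conditional expectation of an integrand: for a $\sigma$-algebra $\mathcal G\subseteq\mathcal F$ and a normal integrand $g$ bounded from below by an integrable random variable, $E^{\mathcal G}g$ denotes the $\mathcal G$-normal integrand such that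 $(E^{\mathcal G}g)(x)=E^{\mathcal G}[g(x)]$ for all $x\in L^0(\Omega,\mathcal G,P;\mathbb R^k)$ (it is known that it exists and is bounded below by the conditional expectation of the lower bound of $g$). Write $E_t=E^{\mathcal F_t}$. The functions $h_t,\tilde h_t:\mathbb R^{n_0+\cdots+n_t}\times\Omega\to\overline{\mathbb R}$ are defined recursively for $t=T,\ldots,0$ by $$\tilde h_T=h,\qquad h_t=E_t\tilde h_t,\qquad \tilde h_{t-1}(x^{t-1},\omega)=\inf_{x_t\in\mathbb R^{n_t}}h_t(x^{t-1},x_t,\omega).$$ "$h_t$ is well-defined" means that the recursion can be carried out down to $t$, i.e. $\tilde h_T,\ldots,\tilde h_t$ are normal integrands whose conditional integrands exist. Horizon function: for $g:\mathbb R^k\to\overline{\mathbb R}$, $$g^\infty(w):=\lim_{\delta\searrow0}\ \inf_{\lambda\in(0,\delta),\ w'\in\mathbb B(w,\delta)}\lambda g(w'/\lambda),$$ where $\mathbb B(w,\delta)$ is the closed ball of radius $\delta$ around $w$. For an integrand, $g^\infty(\cdot,\omega)$ is the horizon function of $g(\cdot,\omega)$; $h^\infty(x)$ denotes the random variable $\omega\mapsto h^\infty(x(\omega),\omega)$. In $h_t^\infty(0,x_t)$ the $0$ is the zero vector of $\mathbb R^{n_0+\cdots+n_{t-1}}$. *)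

theory Defs
  imports "HOL-Probability.Probability"
begin

section \<open>Euclidean spaces of varying dimension\<close>

text \<open>
  Vectors of \<open>R^k\<close> are functions \<open>nat \<Rightarrow> real\<close> vanishing at all indices \<open>i \<ge> k\<close>, with the topology of
  \<^const>\<open>Euclidean_space\<close>. In particular the zero vector of every dimension is \<open>\<lambda>_. 0\<close>, and scalar
  multiplication is pointwise.
\<close>

abbreviation Rvec :: "nat \<Rightarrow> (nat \<Rightarrow> real) set" where
  "Rvec k \<equiv> topspace (Euclidean_space k)"

definition borel_Rvec :: "nat \<Rightarrow> (nat \<Rightarrow> real) measure" where
  "borel_Rvec k = sigma (Rvec k) {U. openin (Euclidean_space k) U}"

definition cball_Rvec :: "nat \<Rightarrow> (nat \<Rightarrow> real) \<Rightarrow> real \<Rightarrow> (nat \<Rightarrow> real) set" where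
  "cball_Rvec k w \<delta> = {w' \<in> Rvec k. L2_set (\<lambda>i. w' i - w i) {..<k} \<le> \<delta>}"

text \<open>\<open>vappend k x y\<close> is the pair \<open>(x, y)\<close>, where \<open>x\<close> has dimension \<open>k\<close>.\<close>

definition vappend :: "nat \<Rightarrow> (nat \<Rightarrow> real) \<Rightarrow> (nat \<Rightarrow> real) \<Rightarrow> (nat \<Rightarrow> real)" where
  "vappend k x y = (\<lambda>i. if i < k then x i else y (i - k))"

section \<open>Normal integrands\<close>

definition lower_semicontinuous_map :: "'b topology \<Rightarrow> ('b \<Rightarrow> ereal) \<Rightarrow> bool" where
  "lower_semicontinuous_map X f \<longleftrightarrow> (\<forall>c. openin X {x \<in> topspace X. c < f x})"

text \<open>Only the \<open>\<sigma>\<close>-algebra of the measure \<open>G\<close> is relevant in the next definition.\<close>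

definition normal_integrand ::
    "'a measure \<Rightarrow> nat \<Rightarrow> ((nat \<Rightarrow> real) \<Rightarrow> 'a \<Rightarrow> ereal) \<Rightarrow> bool" where
  "normal_integrand G k g \<longleftrightarrow>
     (\<lambda>(x, \<omega>). g x \<omega>) \<in> borel_measurable (borel_Rvec k \<Otimes>\<^sub>M G) \<and>
     (\<forall>\<omega>\<in>space G. lower_semicontinuous_map (Euclidean_space k) (\<lambda>x. g x \<omega>))"

definition bounded_below_by ::
    "'a measure \<Rightarrow> nat \<Rightarrow> ((nat \<Rightarrow> real) \<Rightarrow> 'a \<Rightarrow> ereal) \<Rightarrow> ('a \<Rightarrow> real) \<Rightarrow> bool" where
  "bounded_below_by M k g m \<longleftrightarrow>
     integrable M m \<and> (AE \<omega> in M. \<forall>x\<in>Rvec k. ereal (m \<omega>) \<le> g x \<omega>)"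

definition horizon :: "nat \<Rightarrow> ((nat \<Rightarrow> real) \<Rightarrow> ereal) \<Rightarrow> (nat \<Rightarrow> real) \<Rightarrow> ereal" where
  "horizon k g w =
     Lim (at_right (0::real))
       (\<lambda>\<delta>. INF (l, w') \<in> {0<..<\<delta>} \<times> cball_Rvec k w \<delta>. ereal l * g (\<lambda>i. w' i / l))"

section \<open>Conditional expectation\<close>

text \<open>
  Difference of the conditional expectations of the positive and the negative part (\<^const>\<open>e2ennreal\<close>
  maps negative values to 0). The difference is unambiguous almost surely if the negative part is
  integrable.
\<close>

definition ereal_cond_exp :: "'a measure \<Rightarrow> 'a measure \<Rightarrow> ('a \<Rightarrow> ereal) \<Rightarrow> 'a \<Rightarrow> ereal" where
  "ereal_cond_exp M G f = (\<lambda>\<omega>.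
     enn2ereal (nn_cond_exp M G (\<lambda>\<omega>. e2ennreal (f \<omega>)) \<omega>) -
     enn2ereal (nn_cond_exp M G (\<lambda>\<omega>. e2ennreal (- f \<omega>)) \<omega>))"

text \<open>
  \<open>g'\<close> is a version of the conditional integrand \<open>E\<^sup>G g\<close>. It is a relation because conditional
  integrands are determined only up to null sets.
\<close>

definition is_cond_integrand ::
    "'a measure \<Rightarrow> 'a measure \<Rightarrow> nat \<Rightarrow> ((nat \<Rightarrow> real) \<Rightarrow> 'a \<Rightarrow> ereal) \<Rightarrow>
     ((nat \<Rightarrow> real) \<Rightarrow> 'a \<Rightarrow> ereal) \<Rightarrow> bool" where
  "is_cond_integrand M G k g g' \<longleftrightarrow>
     normal_integrand M k g \<and> (\<exists>m. bounded_below_by M k g m) \<and>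
     normal_integrand G k g' \<and>
     (\<forall>x \<in> G \<rightarrow>\<^sub>M borel_Rvec k.
        AE \<omega> in M. g' (x \<omega>) \<omega> = ereal_cond_exp M G (\<lambda>\<omega>. g (x \<omega>) \<omega>) \<omega>)"

section \<open>Dynamic programming\<close>

locale complete_filtered_prob_space = prob_space M + complete_measure M
  for M :: "'a measure" +
  fixes F :: "nat \<Rightarrow> 'a measure" and T :: nat
  assumes subalg: "\<And>t. t \<le> T \<Longrightarrow> subalgebra M (F t)"
    and filtration_mono: "\<And>s t. s \<le> t \<Longrightarrow> t \<le> T \<Longrightarrow> sets (F s) \<subseteq> sets (F t)"
    and filtration_complete: "\<And>t. t \<le> T \<Longrightarrow> null_sets M \<subseteq> sets (F t)"

text \<open>Stage \<open>t\<close> occupies the coordinates \<open>offset n t, \<dots>, offset n (Suc t) - 1\<close>.\<close>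

definition offset :: "(nat \<Rightarrow> nat) \<Rightarrow> nat \<Rightarrow> nat" where
  "offset n t = (\<Sum>s<t. n s)"

definition adapted_processes ::
    "(nat \<Rightarrow> 'a measure) \<Rightarrow> (nat \<Rightarrow> nat) \<Rightarrow> nat \<Rightarrow> (nat \<Rightarrow> 'a \<Rightarrow> nat \<Rightarrow> real) set" where
  "adapted_processes F n T = {x. \<forall>t\<le>T. x t \<in> F t \<rightarrow>\<^sub>M borel_Rvec (n t)}"

text \<open>\<open>history n x t \<omega>\<close> is the vector \<open>(x\<^sub>0(\<omega>), \<dots>, x\<^sub>t\<^sub>-\<^sub>1(\<omega>))\<close>; its dimension is \<open>offset n t\<close>.\<close>

primrec history :: "(nat \<Rightarrow> nat) \<Rightarrow> (nat \<Rightarrow> 'a \<Rightarrow> nat \<Rightarrow> real) \<Rightarrow> nat \<Rightarrow> 'a \<Rightarrow> nat \<Rightarrow> real" where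
  "history n x 0 \<omega> = (\<lambda>_. 0)"
| "history n x (Suc t) \<omega> = vappend (offset n t) (history n x t \<omega>) (x t \<omega>)"

text \<open>\<open>h_tilde n T h H t\<close> is the integrand before conditioning at stage \<open>t\<close>, where \<open>H t\<close> stands for \<open>h\<^sub>t\<close>.\<close>

definition h_tilde ::
    "(nat \<Rightarrow> nat) \<Rightarrow> nat \<Rightarrow> ((nat \<Rightarrow> real) \<Rightarrow> 'a \<Rightarrow> ereal) \<Rightarrow>
     (nat \<Rightarrow> (nat \<Rightarrow> real) \<Rightarrow> 'a \<Rightarrow> ereal) \<Rightarrow> nat \<Rightarrow> (nat \<Rightarrow> real) \<Rightarrow> 'a \<Rightarrow> ereal" where
  "h_tilde n T h H t x \<omega> =
     (if t = T then h x \<omega>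
      else INF y \<in> Rvec (n (Suc t)). H (Suc t) (vappend (offset n (Suc t)) x y) \<omega>)"

text \<open>The recursion can be carried out from \<open>T\<close> down to \<open>t\<close>, with versions \<open>H T, \<dots>, H t\<close> of \<open>h\<^sub>T, \<dots>, h\<^sub>t\<close>.\<close>

definition dp_well_defined ::
    "'a measure \<Rightarrow> (nat \<Rightarrow> 'a measure) \<Rightarrow> (nat \<Rightarrow> nat) \<Rightarrow> nat \<Rightarrow>
     ((nat \<Rightarrow> real) \<Rightarrow> 'a \<Rightarrow> ereal) \<Rightarrow> (nat \<Rightarrow> (nat \<Rightarrow> real) \<Rightarrow> 'a \<Rightarrow> ereal) \<Rightarrow> nat \<Rightarrow> bool" where
  "dp_well_defined M F n T h H t \<longleftrightarrow>
     (\<forall>s\<in>{t..T}. is_cond_integrand M (F s) (offset n (Suc s)) (h_tilde n T h H s) (H s))"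

end

theory Submission
  imports Defs
begin

text \<open>
  If \<open>h\<^sub>t\<^sup>\<infinity>(0, y) \<le> 0\<close> for some \<open>y \<noteq> 0\<close> with positive probability, then \<open>y\<close>, together with scalars \<open>\<lambda>\<^sub>j \<down> 0\<close> and
  vectors \<open>w\<^sub>j \<rightarrow> (0, y)\<close> such that \<open>\<lambda>\<^sub>j h\<^sub>t(w\<^sub>j / \<lambda>\<^sub>j) \<le> 1/j\<close>, can be chosen \<open>F\<^sub>t\<close>-measurably on a set \<open>B\<close>.
  Fatou's lemma moves the inequality inside the conditional expectation, giving \<open>\<le> 0\<close> for the horizon of the
  unconditioned integrand. That integrand is the infimum of \<open>h\<^sub>t\<^sub>+\<^sub>1\<close> over \<open>x\<^sub>t\<^sub>+\<^sub>1\<close>; since \<open>h\<^sub>t\<^sub>+\<^sub>1\<^sup>\<infinity>(0, \<cdot>) > 0\<close> off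
  the origin, minimising sequences stay bounded and a limit \<open>x\<^sub>t\<^sub>+\<^sub>1\<close> satisfies
  \<open>h\<^sub>t\<^sub>+\<^sub>1\<^sup>\<infinity>(0, y, x\<^sub>t\<^sub>+\<^sub>1) \<le> 0\<close>. Iterating up to \<open>T\<close> yields a nonzero adapted process with \<open>h\<^sup>\<infinity> \<le> 0\<close>.
  The integrands are only jointly measurable, so the choices use the selection theorem for sets in
  \<open>B(X) \<otimes> F\<close> with \<open>X\<close> Polish, proved by Souslin's operation and measurable hulls.
\<close>

section \<open>Measurable hulls, Souslin's operation, and selections from product-measurable
  sets\<close>

section \<open>Measurable selection\<close>

text \<open>Minimality up to null sets lets \<open>E\<close> stand in for \<open>A\<close> when
  \<open>A\<close> is not measurable. It is applied to projections, where measurability is not at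
  hand.\<close>

lemma measurable_hull:
  assumes "finite_measure N" "A \<subseteq> space N"
  obtains E where "E \<in> sets N" "A \<subseteq> E" "\<And>F. F \<in> sets N \<Longrightarrow> A \<subseteq> F \<Longrightarrow> E - F \<in> null_sets N"
proof -
  interpret finite_measure N by fact
  have "\<exists>E\<subseteq>(\<Union>n::nat. space N). measurable_envelope N A E"
    by (rule measurable_envelopeI_countable_cover) (use assms emeasure_finite[of "space N"] in \<open>auto simp: less_top[symmetric]\<close>)
  then obtain E where E: "measurable_envelope N A E" by auto
  have "E - F \<in> null_sets N" if "F \<in> sets N" "A \<subseteq> F" for F
  proof -
    have "emeasure N (E - F) = 0"
      by (rule measurable_envelopeD1[OF E]) (use that E in \<open>auto simp: measurable_envelope_def\<close>)
    then show ?thesis using E that by (auto simp: measurable_envelope_def intro!: null_setsI)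
  qed
  then show ?thesis using E that by (auto simp: measurable_envelope_def)
qed

lemma souslin_scheme_selection:
  fixes E :: "nat list \<Rightarrow> 'a set"
  assumes N: "finite_measure N" and E: "\<And>p. E p \<in> sets N"
  obtains \<tau> :: "'a \<Rightarrow> nat \<Rightarrow> nat"
  where "\<And>i. (\<lambda>\<omega>. \<tau> \<omega> i) \<in> N \<rightarrow>\<^sub>M count_space UNIV"
    and "AE \<omega> in N. (\<exists>\<sigma>. \<forall>k. \<omega> \<in> E (map \<sigma> [0..<k])) \<longrightarrow> (\<forall>k. \<omega> \<in> E (map (\<tau> \<omega>) [0..<k]))"
proof -
  \<comment> \<open>Marczewski's argument: up to a null set, a hull of \<open>S p\<close> is covered by the hulls of its successors, so
    the leftmost branch can be followed through the hulls.\<close>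
  define S where "S p = {\<omega>. \<exists>\<sigma>. map \<sigma> [0..<length p] = p \<and> (\<forall>k. \<omega> \<in> E (map \<sigma> [0..<k]))}" for p
  have SE: "S p \<subseteq> E p" for p
    unfolding S_def by (auto dest: spec[of _ "length p"])
  then have "S p \<subseteq> space N" for p using E sets.sets_into_space by blast
  then have "\<exists>W. W \<in> sets N \<and> S p \<subseteq> W \<and> (\<forall>F\<in>sets N. S p \<subseteq> F \<longrightarrow> W - F \<in> null_sets N)" for p
    using measurable_hull[OF N] by metis
  then obtain W0 where W0: "\<And>p. W0 p \<in> sets N" "\<And>p. S p \<subseteq> W0 p"
    "\<And>p F. F \<in> sets N \<Longrightarrow> S p \<subseteq> F \<Longrightarrow> W0 p - F \<in> null_sets N"
    by metis
  \<comment> \<open>\<open>W p\<close> lies between \<open>S p\<close> and \<open>E p\<close>, so a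
    branch through the sets \<open>W\<close> is a branch through \<open>E\<close>.\<close>
  define W where "W p = W0 p \<inter> E p" for p
  have W[measurable]: "W p \<in> sets N" and SW: "S p \<subseteq> W p" and WE: "W p \<subseteq> E p" for p
    using W0 E SE by (auto simp: W_def)
  have split: "S p \<subseteq> (\<Union>i. S (p @ [i]))" for p
  proof
    fix \<omega> assume "\<omega> \<in> S p"
    then obtain \<sigma> where \<sigma>: "map \<sigma> [0..<length p] = p" "\<forall>k. \<omega> \<in> E (map \<sigma> [0..<k])" by (auto simp: S_def)
    then have "\<omega> \<in> S (p @ [\<sigma> (length p)])" by (auto simp: S_def)
    then show "\<omega> \<in> (\<Union>i. S (p @ [i]))" by auto
  qed
  \<comment> \<open>Off \<open>Z\<close>, every prefix whose \<open>W\<close> contains the point has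
    a successor with the same property. \<open>Z\<close> is null: the successors' sets
    \<open>W\<close> form a measurable cover of \<open>S p\<close>, and there are countably many
    lists.\<close>
  define Z where "Z = (\<Union>p. W p - (\<Union>i. W (p @ [i])))"
  have "W p - (\<Union>i. W (p @ [i])) \<in> null_sets N" for p
  proof (rule null_sets_subset)
    show "W p - (\<Union>i. W (p @ [i])) \<in> sets N" by measurable
    show "W0 p - (\<Union>i. W (p @ [i])) \<in> null_sets N"
      using split[of p] SW by (intro W0) fastforce+
  qed (use W in \<open>auto simp: W_def\<close>)
  then have Z: "Z \<in> null_sets N" unfolding Z_def by auto
  define nxt where "nxt p \<omega> = (LEAST i. \<omega> \<in> W (p @ [i]))" for p \<omega>
  define q where "q \<omega> = rec_nat [] (\<lambda>_ p. p @ [nxt p \<omega>])" for \<omega>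
  have q0[simp]: "q \<omega> 0 = []" and qS: "q \<omega> (Suc k) = q \<omega> k @ [nxt (q \<omega> k) \<omega>]" for \<omega> k
    by (auto simp: q_def)
  have nxt_meas[measurable]: "nxt p \<in> N \<rightarrow>\<^sub>M count_space UNIV" for p
    unfolding nxt_def by measurable
  have q_meas[measurable]: "(\<lambda>\<omega>. q \<omega> k) \<in> N \<rightarrow>\<^sub>M count_space UNIV" for k
  proof (induction k)
    case (Suc k)
    note [measurable] = Suc
    have "(\<lambda>\<omega>. (\<lambda>p \<omega>. p @ [nxt p \<omega>]) (q \<omega> k) \<omega>) \<in> N \<rightarrow>\<^sub>M count_space UNIV"
      by (rule measurable_compose_countable) measurable
    then show ?case by (simp add: qS)
  qed simp
  define \<tau> where "\<tau> \<omega> i = nxt (q \<omega> i) \<omega>" for \<omega> i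
  have q_eq: "q \<omega> k = map (\<tau> \<omega>) [0..<k]" for \<omega> k
    by (induction k) (auto simp: qS \<tau>_def)
  have tau_meas: "(\<lambda>\<omega>. \<tau> \<omega> i) \<in> N \<rightarrow>\<^sub>M count_space UNIV" for i
    unfolding \<tau>_def by (rule measurable_compose_countable) measurable
  have branch: "\<omega> \<in> W (q \<omega> k)" if "\<omega> \<in> S []" "\<omega> \<notin> Z" for \<omega> k
  proof (induction k)
    case 0 then show ?case using that SW by auto
  next
    case (Suc k)
    then have "\<exists>i. \<omega> \<in> W (q \<omega> k @ [i])" using that by (auto simp: Z_def)
    then show ?case unfolding qS nxt_def by (rule LeastI_ex)
  qed
  show thesis
  proof (rule that[of \<tau>])
    show "AE \<omega> in N. (\<exists>\<sigma>. \<forall>k. \<omega> \<in> E (map \<sigma> [0..<k])) \<longrightarrow> (\<forall>k. \<omega> \<in> E (map (\<tau> \<omega>) [0..<k]))"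
      using AE_not_in[OF Z]
    proof eventually_elim
      case (elim \<omega>)
      then show ?case using branch[of \<omega>] WE unfolding q_eq by (auto simp: S_def)
    qed
  qed (fact tau_meas)
qed

text \<open>Replaces the usual indexing of Souslin schemes by finite sequences. The index of a
  condition is not tied to the number of coordinates it reads, which makes branches easy to
  recode.\<close>

definition finitely_determined :: "((nat \<Rightarrow> nat) \<Rightarrow> 'b) \<Rightarrow> bool" where
  "finitely_determined R \<longleftrightarrow> (\<exists>b. \<forall>\<sigma> \<tau>. (\<forall>i<b. \<sigma> i = \<tau> i) \<longrightarrow> R \<sigma> = R \<tau>)"

lemma finitely_determined_const: "finitely_determined (\<lambda>_. c)"
  by (auto simp: finitely_determined_def)

lemma finitely_determined_reindex:
  assumes "finitely_determined R"
  shows "finitely_determined (\<lambda>\<sigma>. R (\<lambda>j. \<sigma> (f j)))"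
proof -
  obtain b where b: "\<And>\<sigma> \<tau>. (\<forall>i<b. \<sigma> i = \<tau> i) \<Longrightarrow> R \<sigma> = R \<tau>"
    using assms by (auto simp: finitely_determined_def)
  have "f j < Suc (\<Sum>i<b. f i)" if "j < b" for j
    using that by (auto simp: less_Suc_eq_le intro!: member_le_sum)
  then show ?thesis unfolding finitely_determined_def
    by (intro exI[of _ "Suc (\<Sum>i<b. f i)"] allI impI b) auto
qed

lemma finitely_determined_if:
  assumes "finitely_determined R"
  shows "finitely_determined (\<lambda>\<sigma>. if \<sigma> k = i then R \<sigma> else c)"
proof -
  obtain b where b: "\<And>\<sigma> \<tau>. (\<forall>i<b. \<sigma> i = \<tau> i) \<Longrightarrow> R \<sigma> = R \<tau>"
    using assms by (auto simp: finitely_determined_def)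
  show ?thesis unfolding finitely_determined_def
    by (intro exI[of _ "max b (Suc k)"] allI impI if_cong b) auto
qed

text \<open>Souslin's operation over the family \<open>P\<close>; in the classical scheme,
  \<open>R n\<close> reads only the first \<open>n\<close> coordinates.\<close>

definition souslin :: "'b set set \<Rightarrow> 'b set \<Rightarrow> bool" where
  "souslin P A \<longleftrightarrow> (\<exists>R :: nat \<Rightarrow> (nat \<Rightarrow> nat) \<Rightarrow> 'b set.
     (\<forall>n. finitely_determined (R n)) \<and> (\<forall>n \<sigma>. R n \<sigma> \<in> P) \<and> A = (\<Union>\<sigma>. \<Inter>n. R n \<sigma>))"

lemma souslin_base: "A \<in> P \<Longrightarrow> souslin P A"
  unfolding souslin_def by (intro exI[of _ "\<lambda>_ _. A"]) (auto simp: finitely_determined_const)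

text \<open>Countably many branches are packed into one: the entries at
  \<open>prod_encode (i, j)\<close> form the branch for \<open>A i\<close>, and the conditions are
  listed through the same pairing.\<close>

lemma souslin_INT:
  fixes A :: "nat \<Rightarrow> 'b set"
  assumes "\<And>i. souslin P (A i)"
  shows "souslin P (\<Inter>i. A i)"
proof -
  have "\<forall>i. \<exists>R :: nat \<Rightarrow> _. (\<forall>n. finitely_determined (R n)) \<and> (\<forall>n \<sigma>. R n \<sigma> \<in> P) \<and> A i = (\<Union>\<sigma>. \<Inter>n. R n \<sigma>)"
    by (intro allI assms(1)[unfolded souslin_def])
  from choice[OF this] obtain R :: "nat \<Rightarrow> nat \<Rightarrow> (nat \<Rightarrow> nat) \<Rightarrow> 'b set"
    where R': "\<forall>i. (\<forall>n. finitely_determined (R i n)) \<and> (\<forall>n \<sigma>. R i n \<sigma> \<in> P) \<and> A i = (\<Union>\<sigma>. \<Inter>n. R i n \<sigma>)" ..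
  then have R: "\<And>i n. finitely_determined (R i n)" "\<And>i n \<sigma>. R i n \<sigma> \<in> P"
    and A: "\<And>i. A i = (\<Union>\<sigma>. \<Inter>n. R i n \<sigma>)"
    by simp_all
  define R' where "R' k \<sigma> = (case prod_decode k of (i, n) \<Rightarrow> R i n (\<lambda>j. \<sigma> (prod_encode (i, j))))" for k \<sigma>
  have "(\<Inter>i. A i) = (\<Union>\<sigma>. \<Inter>k. R' k \<sigma>)"
  proof safe
    fix z assume "z \<in> (\<Inter>i. A i)"
    then have "\<exists>\<sigma>. \<forall>n. z \<in> R i n \<sigma>" for i by (auto simp: A)
    then obtain s where s: "\<And>i n. z \<in> R i n (s i)" by metis
    then have "z \<in> (\<Inter>k. R' k (\<lambda>m. case prod_decode m of (i, j) \<Rightarrow> s i j))"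
      by (auto simp: R'_def split: prod.splits)
    then show "z \<in> (\<Union>\<sigma>. \<Inter>k. R' k \<sigma>)" by blast
  next
    fix z \<sigma> i assume "z \<in> (\<Inter>k. R' k \<sigma>)"
    then have "z \<in> R' (prod_encode (i, n)) \<sigma>" for n by blast
    then show "z \<in> A i" unfolding A by (auto simp: R'_def)
  qed
  moreover have "finitely_determined (R' k)" for k
  proof -
    obtain i n where k: "prod_decode k = (i, n)" by fastforce
    have "finitely_determined (\<lambda>\<sigma>. R i n (\<lambda>j. \<sigma> (prod_encode (i, j))))"
      by (rule finitely_determined_reindex[OF R(1)])
    then show ?thesis by (simp add: R'_def[abs_def] k)
  qed
  moreover have "R' k \<sigma> \<in> P" for k \<sigma>
    by (auto simp: R'_def R split: prod.splits)
  ultimately show ?thesis unfolding souslin_def by (intro exI[of _ R'] conjI allI)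
qed

text \<open>Entry 0 of a branch names a member of the union, and the remaining entries form a branch
  for it. The conditions of the other members become \<open>Z\<close>, which contains every set of
  \<open>P\<close>.\<close>

lemma souslin_UN:
  fixes A :: "nat \<Rightarrow> 'b set"
  assumes "\<And>i. souslin P (A i)" and Z: "Z \<in> P" "P \<subseteq> Pow Z"
  shows "souslin P (\<Union>i. A i)"
proof -
  have "\<forall>i. \<exists>R :: nat \<Rightarrow> _. (\<forall>n. finitely_determined (R n)) \<and> (\<forall>n \<sigma>. R n \<sigma> \<in> P) \<and> A i = (\<Union>\<sigma>. \<Inter>n. R n \<sigma>)"
    by (intro allI assms(1)[unfolded souslin_def])
  from choice[OF this] obtain R :: "nat \<Rightarrow> nat \<Rightarrow> (nat \<Rightarrow> nat) \<Rightarrow> 'b set"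
    where R': "\<forall>i. (\<forall>n. finitely_determined (R i n)) \<and> (\<forall>n \<sigma>. R i n \<sigma> \<in> P) \<and> A i = (\<Union>\<sigma>. \<Inter>n. R i n \<sigma>)" ..
  then have R: "\<And>i n. finitely_determined (R i n)" "\<And>i n \<sigma>. R i n \<sigma> \<in> P"
    and A: "\<And>i. A i = (\<Union>\<sigma>. \<Inter>n. R i n \<sigma>)"
    by simp_all
  define R' where "R' k \<sigma> = (case prod_decode k of (i, n) \<Rightarrow> if \<sigma> 0 = i then R i n (\<lambda>j. \<sigma> (Suc j)) else Z)" for k \<sigma>
  have "(\<Union>i. A i) = (\<Union>\<sigma>. \<Inter>k. R' k \<sigma>)"
  proof safe
    fix z i assume "z \<in> A i"
    then obtain \<sigma> where \<sigma>: "\<And>n. z \<in> R i n \<sigma>" by (auto simp: A)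
    moreover have "z \<in> Z" using \<sigma>[of 0] R(2)[of i 0 \<sigma>] Z by auto
    ultimately have "z \<in> (\<Inter>k. R' k (case_nat i \<sigma>))"
      by (auto simp: R'_def split: prod.splits)
    then show "z \<in> (\<Union>\<sigma>. \<Inter>k. R' k \<sigma>)" by blast
  next
    fix z \<sigma> assume "z \<in> (\<Inter>k. R' k \<sigma>)"
    then have "z \<in> R' (prod_encode (\<sigma> 0, n)) \<sigma>" for n by blast
    then have "z \<in> A (\<sigma> 0)" by (auto simp: R'_def A)
    then show "z \<in> (\<Union>i. A i)" by blast
  qed
  moreover have "finitely_determined (R' k)" for k
  proof -
    obtain i n where k: "prod_decode k = (i, n)" by fastforce
    have "finitely_determined (\<lambda>\<sigma>. if \<sigma> 0 = i then R i n (\<lambda>j. \<sigma> (Suc j)) else Z)"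
      by (rule finitely_determined_if[OF finitely_determined_reindex[OF R(1)]])
    then show ?thesis by (simp add: R'_def[abs_def] k)
  qed
  moreover have "R' k \<sigma> \<in> P" for k \<sigma>
    by (auto simp: R'_def R Z split: prod.splits)
  ultimately show ?thesis unfolding souslin_def by (intro exI[of _ R'] conjI allI)
qed

lemma souslin_Un:
  assumes "souslin P A" "souslin P B" "Z \<in> P" "P \<subseteq> Pow Z"
  shows "souslin P (A \<union> B)"
proof -
  have "souslin P (\<Union>i. if i = (0::nat) then A else B)"
    by (rule souslin_UN[of P _ Z]) (use assms in auto)
  also have "(\<Union>i. if i = (0::nat) then A else B) = A \<union> B" by (auto split: if_splits)
  finally show ?thesis .
qed

lemma souslin_Int:
  assumes "souslin P A" "souslin P B"
  shows "souslin P (A \<inter> B)"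
proof -
  have "souslin P (\<Inter>i. if i = (0::nat) then A else B)"
    by (rule souslin_INT) (use assms in auto)
  also have "(\<Inter>i. if i = (0::nat) then A else B) = A \<inter> B" by (auto split: if_splits)
  finally show ?thesis .
qed

section \<open>From the product sigma-algebra to Souslin's operation on closed rectangles\<close>

lemma open_fsigma_metric:
  fixes U :: "'b::metric_space set"
  assumes "open U"
  obtains C :: "nat \<Rightarrow> 'b set" where "\<And>n. closed (C n)" "U = (\<Union>n. C n)"
proof (cases "U = UNIV")
  case True then show ?thesis using that[of "\<lambda>_. UNIV"] by auto
next
  case False
  \<comment> \<open>With empty complement \<open>infdist\<close> is 0 by convention and every
    \<open>C n\<close> would be empty, hence the separate case above.\<close>
  define C where "C n = {x. 1 / real (Suc n) \<le> infdist x (- U)}" for n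
  have "closed (C n)" for n
    unfolding C_def by (intro closed_Collect_le continuous_intros)
  moreover have "U = (\<Union>n. C n)"
  proof safe
    fix x assume "x \<in> U"
    then have "infdist x (- U) > 0"
      using False assms infdist_pos_not_in_closed[of "- U" x] by auto
    then obtain n where "1 / real (Suc n) < infdist x (- U)"
      by (rule nat_approx_posE)
    then show "x \<in> (\<Union>n. C n)" by (auto simp: C_def intro!: exI[of _ n])
  next
    fix x n assume *: "x \<in> C n"
    show "x \<in> U"
    proof (rule ccontr)
      assume "x \<notin> U"
      then have "infdist x (- U) = 0" by (intro infdist_zero) auto
      with * show False by (auto simp: C_def field_simps)
    qed
  qed
  ultimately show ?thesis using that by blast
qed

text \<open>The first factors are closed so that limits of approximating points stay inside; no
  limit is taken in the second factors.\<close>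

definition closed_rectangles :: "'b measure \<Rightarrow> ('a::topological_space \<times> 'b) set set" where
  "closed_rectangles N = {C \<times> F | C F. closed C \<and> F \<in> sets N}"

text \<open>Souslin sets are in general not closed under complements, so the induction over the
  product sigma-algebra carries the complement along in \<open>good\<close>.\<close>

lemma souslin_pair_measure:
  fixes A :: "('a::metric_space \<times> 'b) set"
  assumes "A \<in> sets (borel \<Otimes>\<^sub>M N)"
  shows "souslin (closed_rectangles N) A"
proof -
  let ?P = "closed_rectangles N :: ('a \<times> 'b) set set" and ?Z = "(UNIV :: 'a set) \<times> space N"
  have Z: "?Z \<in> ?P" "?P \<subseteq> Pow ?Z"
    by (auto simp: closed_rectangles_def dest: sets.sets_into_space)
  define good where "good A \<longleftrightarrow> souslin ?P A \<and> souslin ?P (?Z - A) \<and> A \<subseteq> ?Z" for A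
  have compl: "good (?Z - A)" if "good A" for A
    using that by (auto simp: good_def double_diff)
  have UN: "good (\<Union>i. A i)" if "\<And>i::nat. good (A i)" for A
  proof -
    have "souslin ?P (\<Union>i. A i)"
      by (rule souslin_UN[OF _ Z]) (use that in \<open>simp add: good_def\<close>)
    moreover have "souslin ?P (\<Inter>i. ?Z - A i)"
      by (rule souslin_INT) (use that in \<open>simp add: good_def\<close>)
    moreover have "?Z - (\<Union>i. A i) = (\<Inter>i. ?Z - A i)" by blast
    moreover have "(\<Union>i. A i) \<subseteq> ?Z" using that by (auto simp: good_def)
    ultimately show ?thesis by (simp only: good_def)
  qed
  have Int: "good (A \<inter> B)" if "good A" "good B" for A B
  proof -
    have "souslin ?P (A \<inter> B)" "souslin ?P ((?Z - A) \<union> (?Z - B))"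
      using that by (auto simp: good_def intro!: souslin_Un[OF _ _ Z] souslin_Int)
    moreover have "?Z - A \<inter> B = (?Z - A) \<union> (?Z - B)" by blast
    moreover have "A \<inter> B \<subseteq> ?Z" using that by (auto simp: good_def)
    ultimately show ?thesis by (simp only: good_def)
  qed
  have good_snd: "good (UNIV \<times> F)" if "F \<in> sets N" for F
  proof -
    have "?Z - UNIV \<times> F = UNIV \<times> (space N - F)" by auto
    then show ?thesis using that sets.sets_into_space[OF that]
      by (auto simp: good_def closed_rectangles_def intro!: souslin_base)
  qed
  have good_closed: "good (C \<times> space N)" if C: "closed C" for C
  proof -
    \<comment> \<open>The metric enters here: the complement of a closed set is a countable union of
      closed sets.\<close>
    obtain D :: "nat \<Rightarrow> 'a set" where D: "\<And>n. closed (D n)" "- C = (\<Union>n. D n)"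
      using open_fsigma_metric[of "- C"] C by auto
    have "?Z - C \<times> space N = (- C) \<times> space N" by auto
    also have "\<dots> = (\<Union>n. D n \<times> space N)" unfolding D(2) by auto
    also have "souslin ?P \<dots>"
      by (rule souslin_UN[OF _ Z]) (use D in \<open>auto simp: closed_rectangles_def intro!: souslin_base\<close>)
    finally show ?thesis using C
      by (auto simp: good_def closed_rectangles_def intro!: souslin_base)
  qed
  have good_fst: "good (B \<times> space N)" if "B \<in> sets borel" for B
  proof -
    have "B \<in> sigma_sets UNIV (Collect closed)" using that by (simp add: borel_eq_closed)
    then show ?thesis
    proof induction
      case Empty
      then show ?case using good_closed[of "{}"] by auto
    next
      case (Compl a)
      have "(UNIV - a) \<times> space N = ?Z - a \<times> space N" by auto
      then show ?case using compl[OF Compl.IH] by simp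
    next
      case (Union a)
      have "(\<Union>i. a i) \<times> space N = (\<Union>i. a i \<times> space N)" by auto
      then show ?case using UN[OF Union.IH] by simp
    qed (auto intro: good_closed)
  qed
  have "A \<in> sigma_sets ?Z {a \<times> b | a b. a \<in> sets borel \<and> b \<in> sets N}"
    using assms by (simp add: sets_pair_measure)
  then have "good A"
  proof induction
    case (Basic a)
    then obtain B F where a: "a = B \<times> F" "B \<in> sets borel" "F \<in> sets N" by auto
    have "a = (B \<times> space N) \<inter> (UNIV \<times> F)" using a sets.sets_into_space[of F N] by auto
    then show ?case using Int[OF good_fst good_snd] a by auto
  next
    case Empty
    then show ?case using good_closed[of "{}"] by auto
  qed (auto intro: compl UN)
  then show ?thesis by (simp add: good_def)
qed

text \<open>A selection theorem of Aumann type. The projection of \<open>A\<close> need not lie in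
  \<open>N\<close>; measurability of \<open>f\<close> is paid for with an exceptional null
  set.\<close>

theorem measurable_selection:
  fixes A :: "('x::polish_space \<times> 'a) set"
  assumes N: "finite_measure N" and A: "A \<in> sets (borel \<Otimes>\<^sub>M N)"
  obtains f where "f \<in> N \<rightarrow>\<^sub>M borel" "AE \<omega> in N. (\<exists>x. (x, \<omega>) \<in> A) \<longrightarrow> (f \<omega>, \<omega>) \<in> A"
proof -
  obtain R :: "nat \<Rightarrow> (nat \<Rightarrow> nat) \<Rightarrow> ('x \<times> 'a) set"
    where R': "(\<forall>n. finitely_determined (R n)) \<and> (\<forall>n \<sigma>. R n \<sigma> \<in> closed_rectangles N) \<and> A = (\<Union>\<sigma>. \<Inter>n. R n \<sigma>)"
    using souslin_pair_measure[OF A] unfolding souslin_def ..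
  then have R: "\<And>n. finitely_determined (R n)" "\<And>n \<sigma>. R n \<sigma> \<in> closed_rectangles N"
    and A_eq: "A = (\<Union>\<sigma>. \<Inter>n. R n \<sigma>)"
    by simp_all
  have "\<forall>n. \<exists>b. \<forall>\<sigma> \<tau>. (\<forall>i<b. \<sigma> i = \<tau> i) \<longrightarrow> R n \<sigma> = R n \<tau>"
    using R(1) by (simp add: finitely_determined_def)
  then obtain b where b: "\<And>n \<sigma> \<tau>. (\<forall>i<b n. \<sigma> i = \<tau> i) \<Longrightarrow> R n \<sigma> = R n \<tau>"
    by metis
  have "\<exists>C. \<exists>F\<in>sets N. closed C \<and> S = C \<times> F" if "S \<in> closed_rectangles N" for S :: "('x \<times> 'a) set"
    using that by (auto simp: closed_rectangles_def)
  then obtain cl ms where rect: "\<And>S. S \<in> closed_rectangles N \<Longrightarrow>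
      closed (cl S :: 'x set) \<and> ms S \<in> sets N \<and> S = cl S \<times> ms S"
    by metis
  obtain D :: "'x set" where D: "countable D" "\<And>X. open X \<Longrightarrow> X \<noteq> {} \<Longrightarrow> \<exists>d\<in>D. d \<in> X"
    using countable_dense_exists by metis
  define d where "d = from_nat_into D"
  have "D \<noteq> {}" using D(2)[of UNIV] by auto
  have dense: "\<exists>i. dist (d i) x \<le> e" if e: "e > 0" for x e
  proof -
    obtain z where z: "z \<in> D" "z \<in> ball x e" using D(2)[of "ball x e"] e by auto
    then obtain i where "d i = z" unfolding d_def using D(1) from_nat_into_surj by metis
    then show ?thesis using z by (auto simp: dist_commute intro!: exI[of _ i])
  qed
  \<comment> \<open>A code \<open>\<sigma>\<close> carries a branch \<open>\<alpha> \<sigma>\<close> of the Souslin scheme and indices \<open>s \<sigma>\<close> of points of the dense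
    sequence converging to the selected point; this turns \<open>A\<close> into a scheme \<open>E\<close> on the measure space alone.\<close>
  define \<alpha> where "\<alpha> \<sigma> i = fst (prod_decode (\<sigma> i))" for \<sigma> and i :: nat
  define s where "s \<sigma> i = snd (prod_decode (\<sigma> i))" for \<sigma> and i :: nat
  \<comment> \<open>Prefixes are filled up with zeros so that \<open>R\<close> and \<open>s\<close>
    can be applied to them. The filling has no effect, since only conditions settled by the prefix
    are imposed.\<close>
  define pad where "pad p i = (if i < length p then p ! i else 0)" for p :: "nat list" and i
  define K where "K p = {x. (\<forall>n\<le>length p. b n \<le> length p \<longrightarrow> x \<in> cl (R n (\<alpha> (pad p)))) \<and>
    (\<forall>i<length p. dist (d (s (pad p) i)) x \<le> (1/2)^i)}" for p
  define G where "G p = {\<omega>\<in>space N. \<forall>n\<in>{..length p}. b n \<le> length p \<longrightarrow> \<omega> \<in> ms (R n (\<alpha> (pad p)))}" for p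
  \<comment> \<open>The rectangle shape of \<open>R n\<close> separates the conditions on the
    selected point (\<open>K\<close>) from those on the outcome (\<open>G\<close>). Whether
    \<open>K p\<close> is empty does not depend on the outcome, so \<open>E p\<close> is
    measurable.\<close>
  define E where "E p = (if K p = {} then {} else G p)" for p
  have [measurable]: "ms (R n \<sigma>) \<in> sets N" for n \<sigma> using rect[OF R(2)] by auto
  have "G p \<in> sets N" for p unfolding G_def by measurable
  then have E_sets: "E p \<in> sets N" for p by (auto simp: E_def)
  have pad_map: "pad (map \<sigma> [0..<k]) i = \<sigma> i" if "i < k" for \<sigma> i k
    using that by (simp add: pad_def)
  have R_pad: "R n (\<alpha> (pad (map \<sigma> [0..<k]))) = R n (\<alpha> \<sigma>)" if "b n \<le> k" for n k \<sigma>
    by (rule b) (use that in \<open>auto simp: \<alpha>_def pad_map\<close>)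
  have ex_branch: "\<exists>\<sigma>. \<forall>k. \<omega> \<in> E (map \<sigma> [0..<k])" if xA: "(x, \<omega>) \<in> A" for x \<omega>
  proof -
    obtain a where a: "\<And>n. (x, \<omega>) \<in> R n a" using xA unfolding A_eq by blast
    have "\<forall>i::nat. \<exists>j. dist (d j) x \<le> (1/2)^i" by (intro allI dense) auto
    then obtain r where r: "\<And>i. dist (d (r i)) x \<le> (1/2)^i" by metis
    define \<sigma> where "\<sigma> i = prod_encode (a i, r i)" for i
    have \<sigma>: "\<alpha> \<sigma> = a" "s \<sigma> = r" by (auto simp: \<alpha>_def s_def \<sigma>_def)
    have a': "x \<in> cl (R n a)" "\<omega> \<in> ms (R n a)" for n
      using a[of n] rect[OF R(2)[of n a]] by auto
    then have "\<omega> \<in> space N" using sets.sets_into_space[of "ms (R 0 a)" N] by auto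
    have "s (pad (map \<sigma> [0..<k])) i = r i" if "i < k" for i k
      using that \<sigma>(2) by (auto simp: s_def pad_map)
    then have "x \<in> K (map \<sigma> [0..<k])" "\<omega> \<in> G (map \<sigma> [0..<k])" for k
      using a' r \<open>\<omega> \<in> space N\<close> by (auto simp: K_def G_def R_pad \<sigma>)
    then show ?thesis by (auto simp: E_def intro!: exI[of _ \<sigma>])
  qed
  have branch_limit: "\<exists>x. (\<lambda>i. d (s \<sigma> i)) \<longlonglongrightarrow> x \<and> (x, \<omega>) \<in> A"
    if \<sigma>: "\<And>k. \<omega> \<in> E (map \<sigma> [0..<k])" for \<sigma> \<omega>
  proof -
    have "\<forall>k. \<exists>y. y \<in> K (map \<sigma> [0..<k])" 
    proof
      fix k show "\<exists>y. y \<in> K (map \<sigma> [0..<k])"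
        using \<sigma>[of k] by (auto simp: E_def split: if_splits)
    qed
    then obtain y where y: "\<And>k. y k \<in> K (map \<sigma> [0..<k])" by metis
    have sp: "s (pad (map \<sigma> [0..<k])) i = s \<sigma> i" if "i < k" for i k
      using that by (auto simp: s_def pad_map)
    have dy: "dist (d (s \<sigma> i)) (y k) \<le> (1/2)^i" if "i < k" for i k
      using y[of k] that by (auto simp: K_def sp)
    have half: "(\<lambda>i. (1/2)^i :: real) \<longlonglongrightarrow> 0" by (rule LIMSEQ_realpow_zero) auto
    \<comment> \<open>For \<open>k\<close> and \<open>l\<close> above \<open>i\<close>, both
      \<open>y k\<close> and \<open>y l\<close> are within \<open>(1/2)^i\<close> of the same point
      of the dense sequence.\<close>
    have "Cauchy y"
    proof (rule metric_CauchyI)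
      fix e :: real assume "e > 0"
      then obtain i where i: "(1/2)^i < e / 2"
        using order_tendstoD(2)[OF half, of "e / 2"] by (auto simp: eventually_sequentially)
      have "dist (y k) (y l) < e" if "k \<ge> Suc i" "l \<ge> Suc i" for k l
        using dy[of i k] dy[of i l] i that dist_triangle3[of "y k" "y l" "d (s \<sigma> i)"] by auto
      then show "\<exists>M. \<forall>m\<ge>M. \<forall>n\<ge>M. dist (y m) (y n) < e" by blast
    qed
    then obtain x where x: "y \<longlonglongrightarrow> x" using Cauchy_convergent convergent_def by blast
    have "dist (d (s \<sigma> i)) x \<le> (1/2)^i" for i
    proof (rule LIMSEQ_le_const2)
      show "(\<lambda>k. dist (d (s \<sigma> i)) (y k)) \<longlonglongrightarrow> dist (d (s \<sigma> i)) x" by (intro tendsto_intros x)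
    qed (use dy in \<open>auto intro!: exI[of _ "Suc i"]\<close>)
    then have "(\<lambda>i. d (s \<sigma> i)) \<longlonglongrightarrow> x"
      by (intro metric_tendsto_imp_tendsto[OF half]) (auto simp: dist_real_def)
    moreover have "(x, \<omega>) \<in> R n (\<alpha> \<sigma>)" for n
    proof -
      have "x \<in> cl (R n (\<alpha> \<sigma>))"
      proof (rule Lim_in_closed_set[OF _ _ _ x])
        show "closed (cl (R n (\<alpha> \<sigma>)))" using rect[OF R(2)] by auto
        show "\<forall>\<^sub>F k in sequentially. y k \<in> cl (R n (\<alpha> \<sigma>))"
          using eventually_ge_at_top[of "max n (b n)"]
        proof eventually_elim
          case (elim k)
          then show ?case using y[of k] by (auto simp: K_def R_pad)
        qed
      qed auto
      moreover have "\<omega> \<in> ms (R n (\<alpha> \<sigma>))"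
        using \<sigma>[of "max n (b n)"] R_pad[of n "max n (b n)" \<sigma>]
        by (auto simp: E_def G_def split: if_splits dest!: bspec[of _ _ n])
      ultimately show ?thesis using rect[OF R(2)[of n "\<alpha> \<sigma>"]] by auto
    qed
    ultimately show ?thesis using A_eq by blast
  qed
  obtain \<tau> where [measurable]: "\<And>i. (\<lambda>\<omega>. \<tau> \<omega> i) \<in> N \<rightarrow>\<^sub>M count_space UNIV"
    and \<tau>: "AE \<omega> in N. (\<exists>\<sigma>. \<forall>k. \<omega> \<in> E (map \<sigma> [0..<k])) \<longrightarrow> (\<forall>k. \<omega> \<in> E (map (\<tau> \<omega>) [0..<k]))"
    by (rule souslin_scheme_selection[where E = E, OF N E_sets]) blast
  define u where "u i \<omega> = d (s (\<tau> \<omega>) i)" for i \<omega>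
  have u[measurable]: "u i \<in> N \<rightarrow>\<^sub>M borel" for i
    unfolding u_def s_def by measurable
  \<comment> \<open>Replacing divergent sequences by a constant makes \<open>v\<close> converge
    everywhere, so its pointwise limit is measurable.\<close>
  define v where "v i \<omega> = (if Cauchy (\<lambda>i. u i \<omega>) then u i \<omega> else d 0)" for i \<omega>
  define f where "f \<omega> = lim (\<lambda>i. v i \<omega>)" for \<omega>
  show thesis
  proof (rule that[of f])
    show "f \<in> N \<rightarrow>\<^sub>M borel"
    proof (rule borel_measurable_LIMSEQ_metric)
      show "v i \<in> N \<rightarrow>\<^sub>M borel" for i unfolding v_def by measurable
      show "(\<lambda>i. v i \<omega>) \<longlonglongrightarrow> f \<omega>" for \<omega>
        unfolding f_def convergent_LIMSEQ_iff[symmetric]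
        by (cases "Cauchy (\<lambda>i. u i \<omega>)") (auto simp: v_def Cauchy_convergent convergent_const)
    qed
    show "AE \<omega> in N. (\<exists>x. (x, \<omega>) \<in> A) \<longrightarrow> (f \<omega>, \<omega>) \<in> A"
      using \<tau>
    proof eventually_elim
      case (elim \<omega>)
      show ?case
      proof
        assume "\<exists>x. (x, \<omega>) \<in> A"
        then have "\<forall>k. \<omega> \<in> E (map (\<tau> \<omega>) [0..<k])" using elim ex_branch by blast
        then obtain x where x: "(\<lambda>i. u i \<omega>) \<longlonglongrightarrow> x" "(x, \<omega>) \<in> A"
          using branch_limit[of \<omega> "\<tau> \<omega>"] by (auto simp: u_def)
        then have "f \<omega> = x"
          using limI LIMSEQ_imp_Cauchy[OF x(1)] by (auto simp: f_def v_def)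
        then show "(f \<omega>, \<omega>) \<in> A" using x by simp
      qed
    qed
  qed
qed

section \<open>Coordinates of \<open>Rvec k\<close>, and limit-free descriptions of horizon
  functions\<close>

section \<open>Horizon functions\<close>

text \<open>\<open>Rvec k\<close> carries the subspace topology of
  \<open>nat \<Rightarrow> real\<close> and is closed there, so its Borel sets are traces of Borel
  sets. Measurability can then be checked coordinate by coordinate.\<close>

lemma sets_borel_Rvec: "sets (borel_Rvec k) = sets (restrict_space borel (Rvec k))"
proof -
  have "closed (Rvec k)"
    using closedin_Euclidean_space by (simp add: euclidean_product_topology)
  then have R: "Rvec k \<in> sigma_sets UNIV {S. open S}"
    using borel_closed[of "Rvec k"] by (simp add: borel_def)
  have "{U. openin (Euclidean_space k) U} = (\<inter>) (Rvec k) ` {S. open S}"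
    by (auto simp: Euclidean_space_def openin_subtopology euclidean_product_topology)
  then have "sets (borel_Rvec k) = sigma_sets (Rvec k) ((\<inter>) (Rvec k) ` {S. open S})"
    unfolding borel_Rvec_def by (subst sets_measure_of) auto
  also have "\<dots> = (\<inter>) (Rvec k) ` sigma_sets UNIV {S. open S}"
    by (rule sigma_sets_Int[symmetric]) (use R in auto)
  finally show ?thesis by (simp add: sets_restrict_space borel_def)
qed

lemma space_borel_Rvec: "space (borel_Rvec k) = Rvec k"
  unfolding borel_Rvec_def by (rule space_measure_of) (auto dest: openin_subset)

lemma measurable_borel_Rvec_iff:
  "f \<in> G \<rightarrow>\<^sub>M borel_Rvec k \<longleftrightarrow>
    f \<in> space G \<rightarrow> Rvec k \<and> (\<forall>i. (\<lambda>\<omega>. f \<omega> i) \<in> borel_measurable G)"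
proof -
  have "f \<in> G \<rightarrow>\<^sub>M borel_Rvec k \<longleftrightarrow> f \<in> G \<rightarrow>\<^sub>M restrict_space borel (Rvec k)"
    by (simp add: measurable_cong_sets[OF refl sets_borel_Rvec])
  also have "\<dots> = (f \<in> space G \<rightarrow> Rvec k \<and> f \<in> borel_measurable G)"
    by (auto simp: measurable_restrict_space2_iff)
  also have "(f \<in> borel_measurable G) =  (\<forall>i. (\<lambda>\<omega>. f \<omega> i) \<in> borel_measurable G)"
  proof
    assume "f \<in> borel_measurable G"
    then show "\<forall>i. (\<lambda>\<omega>. f \<omega> i) \<in> borel_measurable G"
      using measurable_product_then_coordinatewise[of f G] by simp
  next
    assume "\<forall>i. (\<lambda>\<omega>. f \<omega> i) \<in> borel_measurable G"
    then show "f \<in> borel_measurable G"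
      using measurable_coordinatewise_then_product[of f G] by simp
  qed
  finally show ?thesis .
qed

lemma Rvec_iff: "x \<in> Rvec k \<longleftrightarrow> (\<forall>i\<ge>k. x i = 0)"
  by (simp add: topspace_Euclidean_space)

lemma vappend_in_Rvec: "x \<in> Rvec k \<Longrightarrow> y \<in> Rvec d \<Longrightarrow> vappend k x y \<in> Rvec (k + d)"
  by (auto simp: Rvec_iff vappend_def)

text \<open>A limit-free form of \<open>horizon k g w \<le> 0\<close>. One \<open>e\<close> bounds
  the scalar, the radius and the value at once, so the choices \<open>e = 1 / Suc j\<close> yield
  sequences of witnesses.\<close>

definition horizon_nonpos :: "nat \<Rightarrow> ((nat \<Rightarrow> real) \<Rightarrow> ereal) \<Rightarrow> (nat \<Rightarrow> real) \<Rightarrow> bool" where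
  "horizon_nonpos k g w \<longleftrightarrow>
     (\<forall>e>0. \<exists>l w'. 0 < l \<and> l < e \<and> w' \<in> cball_Rvec k w e \<and> ereal l * g (\<lambda>i. w' i / l) < ereal e)"

lemma cball_Rvec_mono: "d \<le> e \<Longrightarrow> cball_Rvec k w d \<subseteq> cball_Rvec k w e"
  by (auto simp: cball_Rvec_def)

text \<open>The infimum grows as \<open>\<delta>\<close> shrinks, so the limit at 0 is a supremum,
  and it is at most 0 iff every infimum is.\<close>

lemma horizon_le_0_iff: "horizon k g w \<le> 0 \<longleftrightarrow> horizon_nonpos k g w"
proof -
  define \<phi> where "\<phi> \<delta> = (INF (l, w') \<in> {0<..<\<delta>} \<times> cball_Rvec k w \<delta>. ereal l * g (\<lambda>i. w' i / l))" for \<delta> :: real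
  have anti: "\<phi> e \<le> \<phi> d" if "d \<le> e" for d e
    unfolding \<phi>_def using that cball_Rvec_mono[OF that]
    by (intro INF_superset_mono) auto
  have lim: "(\<phi> \<longlongrightarrow> (SUP \<delta>\<in>{0<..}. \<phi> \<delta>)) (at_right 0)"
  proof (rule order_tendstoI)
    fix a assume "a < (SUP \<delta>\<in>{0<..}. \<phi> \<delta>)"
    then obtain d where d: "d > 0" "a < \<phi> d" by (auto simp: less_SUP_iff)
    have "a < \<phi> x" if "0 < x" "x < d" for x using d anti[of x d] that by auto
    then show "\<forall>\<^sub>F x in at_right 0. a < \<phi> x"
      using d by (auto simp: eventually_at_right_field)
  next
    fix a assume a: "(SUP \<delta>\<in>{0<..}. \<phi> \<delta>) < a"
    have "\<phi> x < a" if "x > 0" for x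
      using that by (intro le_less_trans[OF _ a] SUP_upper) auto
    then show "\<forall>\<^sub>F x in at_right 0. \<phi> x < a"
      by (auto simp: eventually_at_right_field intro!: exI[of _ 1])
  qed
  have "horizon k g w = (SUP \<delta>\<in>{0<..}. \<phi> \<delta>)"
    unfolding horizon_def \<phi>_def[symmetric, abs_def]
    by (rule tendsto_Lim[OF _ lim]) simp
  then have "horizon k g w \<le> 0 \<longleftrightarrow> (\<forall>\<delta>>0. \<phi> \<delta> \<le> 0)"
    by (auto simp: SUP_le_iff)
  also have "\<dots> \<longleftrightarrow> horizon_nonpos k g w"
  proof
    assume *: "\<forall>\<delta>>0. \<phi> \<delta> \<le> 0"
    show "horizon_nonpos k g w" unfolding horizon_nonpos_def
    proof (intro allI impI)
      fix e :: real assume e: "e > 0"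
      then have "\<phi> e < ereal e" using * le_less_trans[of "\<phi> e" 0 "ereal e"] by simp
      then show "\<exists>l w'. 0 < l \<and> l < e \<and> w' \<in> cball_Rvec k w e \<and> ereal l * g (\<lambda>i. w' i / l) < ereal e"
        unfolding \<phi>_def INF_less_iff by auto
    qed
  next
    assume *: "horizon_nonpos k g w"
    show "\<forall>\<delta>>0. \<phi> \<delta> \<le> 0"
    proof (intro allI impI)
      fix \<delta> :: real assume \<delta>: "\<delta> > 0"
      show "\<phi> \<delta> \<le> 0"
      proof (rule ereal_le_epsilon2)
        fix e :: real assume "e > 0"
        \<comment> \<open>The choice \<open>min \<delta> e\<close> puts the witness in the region
          belonging to \<open>\<delta>\<close> and its value below \<open>e\<close>.\<close>
        then obtain l w' where l: "0 < l" "l < min \<delta> e" "w' \<in> cball_Rvec k w (min \<delta> e)"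
          "ereal l * g (\<lambda>i. w' i / l) < ereal (min \<delta> e)"
          using *[unfolded horizon_nonpos_def, rule_format, of "min \<delta> e"] \<delta> by auto
        then have "\<phi> \<delta> \<le> ereal l * g (\<lambda>i. w' i / l)"
          unfolding \<phi>_def using cball_Rvec_mono[of "min \<delta> e" \<delta> k w]
          by (intro INF_lower2[of "(l, w')"]) auto
        also have "\<dots> \<le> ereal (min \<delta> e)" using l(4) by (rule less_imp_le)
        also have "\<dots> \<le> ereal e" by simp
        finally show "\<phi> \<delta> \<le> 0 + ereal e" by simp
      qed
    qed
  qed
  finally show ?thesis .
qed

lemma horizon_pos_iff: "0 < horizon k g w \<longleftrightarrow> \<not> horizon_nonpos k g w"
  using horizon_le_0_iff[of k g w] by auto

text \<open>The dimension is finite, so coordinatewise convergence of \<open>v\<close> forces its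
  distance to \<open>w\<close> to 0. Limits of subsequences are turned into nonpositive horizon
  values this way.\<close>

lemma horizon_nonpos_limit:
  assumes "\<forall>\<^sub>F j in sequentially. 0 < l j \<and> v j \<in> Rvec k \<and> ereal (l j) * g (\<lambda>i. v j i / l j) < ereal (c j)"
    and l: "l \<longlonglongrightarrow> 0" and c: "c \<longlonglongrightarrow> 0" and v: "\<And>i. (\<lambda>j. v j i) \<longlonglongrightarrow> w i"
  shows "horizon_nonpos k g w"
  unfolding horizon_nonpos_def
proof (intro allI impI)
  fix e :: real assume e: "e > 0"
  have "(\<lambda>j. L2_set (\<lambda>i. v j i - w i) {..<k}) \<longlonglongrightarrow> L2_set (\<lambda>i. w i - w i) {..<k}"
    unfolding L2_set_def by (intro tendsto_intros v)
  then have L2: "(\<lambda>j. L2_set (\<lambda>i. v j i - w i) {..<k}) \<longlonglongrightarrow> 0"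
    by (simp add: L2_set_def)
  have "\<forall>\<^sub>F j in sequentially. 0 < l j \<and> l j < e \<and> v j \<in> cball_Rvec k w e \<and>
      ereal (l j) * g (\<lambda>i. v j i / l j) < ereal e"
    using assms(1) order_tendstoD(2)[OF l e] order_tendstoD(2)[OF c e] order_tendstoD(2)[OF L2 e]
  proof eventually_elim
    case (elim j)
    then show ?case using less_trans[of "ereal (l j) * g (\<lambda>i. v j i / l j)" "ereal (c j)" "ereal e"]
      by (auto simp: cball_Rvec_def)
  qed
  then show "\<exists>l w'. 0 < l \<and> l < e \<and> w' \<in> cball_Rvec k w e \<and> ereal l * g (\<lambda>i. w' i / l) < ereal e"
    unfolding eventually_sequentially by blast
qed

text \<open>Bolzano-Weierstrass by way of Tychonoff: the cube with sides \<open>{-R..R}\<close> is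
  compact in the product topology, hence sequentially compact.\<close>

lemma bounded_coordinates_subseq:
  fixes u :: "nat \<Rightarrow> nat \<Rightarrow> real"
  assumes "\<And>j i. \<bar>u j i\<bar> \<le> R"
  obtains s v where "strict_mono s" "\<And>i. (\<lambda>j. u (s j) i) \<longlonglongrightarrow> v i"
proof -
  have "compactin (product_topology (\<lambda>_::nat. euclidean) UNIV) (PiE UNIV (\<lambda>_. {-R..R}))"
    by (subst compactin_PiE) auto
  then have "compact (PiE UNIV (\<lambda>_::nat. {-R..R}))"
    by (simp add: euclidean_product_topology)
  then have "seq_compact (PiE UNIV (\<lambda>_::nat. {-R..R}))"
    by (rule compact_imp_seq_compact)
  moreover have "\<forall>j. u j \<in> PiE UNIV (\<lambda>_. {-R..R})"
  proof
    fix j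
    have "- R \<le> u j i \<and> u j i \<le> R" for i using assms[of j i] by linarith
    then show "u j \<in> PiE UNIV (\<lambda>_. {-R..R})" by (simp add: PiE_def)
  qed
  ultimately obtain v s where "strict_mono s" "(u \<circ> s) \<longlonglongrightarrow> v"
    using seq_compactE by blast
  then show thesis
    using that[of s v] continuous_on_tendsto_compose[OF continuous_on_product_coordinates, of "u \<circ> s" v sequentially]
    by (simp add: comp_def)
qed

lemma inverse_Suc_tendsto_0: "(\<lambda>j. 1 / real (Suc j)) \<longlonglongrightarrow> 0"
  using LIMSEQ_inverse_real_of_nat by (simp add: inverse_eq_divide)

lemma L2_set_abs: "L2_set (\<lambda>i. \<bar>f i\<bar>) A = L2_set f A"
  by (simp add: L2_set_def)

text \<open>Near-minimisers, rescaled by \<open>l\<close>, may stay bounded along a subsequence, and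
  then a limit is the required \<open>u\<close>. Otherwise they tend to infinity; normalised, they
  have a limit direction of norm 1 whose horizon value over the zero vector is nonpositive, against
  \<open>pos\<close>.\<close>

lemma horizon_nonpos_inf_projection:
  assumes pos: "\<And>y. y \<in> Rvec d \<Longrightarrow> y \<noteq> (\<lambda>_. 0) \<Longrightarrow>
      \<not> horizon_nonpos (k + d) g (vappend k (\<lambda>_. 0) y)"
    and w: "w \<in> Rvec k"
    and hn: "horizon_nonpos k (\<lambda>x. INF y\<in>Rvec d. g (vappend k x y)) w"
  shows "\<exists>u\<in>Rvec d. horizon_nonpos (k + d) g (vappend k w u)"
proof -
  have "\<forall>j. \<exists>l w' y. 0 < l \<and> l < 1 / real (Suc j) \<and> w' \<in> cball_Rvec k w (1 / real (Suc j)) \<and>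
      y \<in> Rvec d \<and> ereal l * g (vappend k (\<lambda>i. w' i / l) y) < ereal (1 / real (Suc j))"
  proof
    fix j
    obtain l w' where l: "0 < l" "l < 1 / real (Suc j)" "w' \<in> cball_Rvec k w (1 / real (Suc j))"
      "ereal l * (INF y\<in>Rvec d. g (vappend k (\<lambda>i. w' i / l) y)) < ereal (1 / real (Suc j))"
      using hn[unfolded horizon_nonpos_def, rule_format, of "1 / real (Suc j)"] by auto
    then have "(INF y\<in>Rvec d. g (vappend k (\<lambda>i. w' i / l) y)) < ereal (1 / real (Suc j)) / ereal l"
      by (subst ereal_less_divide_pos) auto
    then obtain y where "y \<in> Rvec d" "g (vappend k (\<lambda>i. w' i / l) y) < ereal (1 / real (Suc j)) / ereal l"
      unfolding INF_less_iff by blast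
    then show "\<exists>l w' y. 0 < l \<and> l < 1 / real (Suc j) \<and> w' \<in> cball_Rvec k w (1 / real (Suc j)) \<and>
      y \<in> Rvec d \<and> ereal l * g (vappend k (\<lambda>i. w' i / l) y) < ereal (1 / real (Suc j))"
      using l ereal_less_divide_pos[of "ereal l" "g (vappend k (\<lambda>i. w' i / l) y)" "ereal (1 / real (Suc j))"]
      by (intro exI[of _ l] exI[of _ w'] exI[of _ y]) auto
  qed
  then obtain l w' y where l: "\<And>j. 0 < l j" "\<And>j. l j < 1 / real (Suc j)"
    and w': "\<And>j. w' j \<in> cball_Rvec k w (1 / real (Suc j))" and y: "\<And>j. y j \<in> Rvec d"
    and g: "\<And>j. ereal (l j) * g (vappend k (\<lambda>i. w' j i / l j) (y j)) < ereal (1 / real (Suc j))"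
    by metis
  \<comment> \<open>Dividing the pair \<open>(w', u)\<close> by \<open>l\<close> returns the
    argument at which \<open>g\<close> is small.\<close>
  define u where "u j i = l j * y j i" for j i
  define r where "r j = L2_set (u j) {..<d}" for j
  have u: "u j \<in> Rvec d" for j using y by (auto simp: u_def Rvec_iff)
  have w'_Rvec: "w' j \<in> Rvec k" for j using w' by (auto simp: cball_Rvec_def)
  have scale: "vappend k (w' j) (u j) i / l j = vappend k (\<lambda>i. w' j i / l j) (y j) i" for j i
    using l(1)[of j] by (auto simp: vappend_def u_def)
  have u_le: "\<bar>u j i\<bar> \<le> r j" for j i
  proof (cases "i < d")
    case True
    then have "\<bar>u j i\<bar> \<le> L2_set (\<lambda>i. \<bar>u j i\<bar>) {..<d}" by (intro member_le_L2_set) auto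
    then show ?thesis by (simp add: r_def L2_set_abs)
  next
    case False
    then show ?thesis using u[of j] by (simp add: Rvec_iff r_def L2_set_nonneg)
  qed
  have l0: "l \<longlonglongrightarrow> 0"
    by (rule tendsto_sandwich[OF _ _ tendsto_const inverse_Suc_tendsto_0])
      (intro always_eventually allI less_imp_le l)+
  have w'_lim: "(\<lambda>j. w' j i) \<longlonglongrightarrow> w i" for i
  proof (cases "i < k")
    case True
    have "\<bar>w' j i - w i\<bar> \<le> 1 / real (Suc j)" for j
    proof -
      have "\<bar>w' j i - w i\<bar> \<le> L2_set (\<lambda>i. \<bar>w' j i - w i\<bar>) {..<k}"
        using True by (intro member_le_L2_set) auto
      then show ?thesis using w'[of j] by (simp add: L2_set_abs cball_Rvec_def)
    qed
    then have "(\<lambda>j. w' j i - w i) \<longlonglongrightarrow> 0"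
      by (intro Lim_null_comparison[OF _ inverse_Suc_tendsto_0]) auto
    then show ?thesis by (simp add: LIM_zero_iff)
  next
    case False
    then show ?thesis using w'_Rvec w by (simp add: Rvec_iff)
  qed
  have Rvec_lim: "v \<in> Rvec d" if "\<And>i. (\<lambda>j. z j i) \<longlonglongrightarrow> v i" "\<And>j. z j \<in> Rvec d" for z v
  proof -
    have "v i = 0" if "i \<ge> d" for i
      using LIMSEQ_unique[OF \<open>\<And>i. (\<lambda>j. z j i) \<longlonglongrightarrow> v i\<close>[of i], of 0] that
        \<open>\<And>j. z j \<in> Rvec d\<close> by (simp add: Rvec_iff)
    then show ?thesis by (simp add: Rvec_iff)
  qed
  show ?thesis
  \<comment> \<open>Only a bounded subsequence is asked for; if there is none, the whole sequence
    \<open>r\<close> tends to infinity.\<close>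
  proof (cases "\<exists>R. \<exists>\<^sub>\<infinity>j. r j \<le> R")
    case True
    then obtain R where "infinite {j. r j \<le> R}" by (auto simp: frequently_cofinite)
    from infinite_enumerate[OF this] obtain s0 :: "nat \<Rightarrow> nat"
      where s0: "strict_mono s0" "\<And>j. r (s0 j) \<le> R" by auto
    have "\<bar>u (s0 j) i\<bar> \<le> R" for j i using u_le[of "s0 j" i] s0(2)[of j] by linarith
    then obtain s1 v where s1: "strict_mono s1" "\<And>i. (\<lambda>j. u (s0 (s1 j)) i) \<longlonglongrightarrow> v i"
      by (rule bounded_coordinates_subseq[of "\<lambda>j. u (s0 j)"]) blast
    define s where "s = s0 \<circ> s1"
    have s: "strict_mono s" unfolding s_def by (rule strict_mono_o[OF s0(1) s1(1)])
    note sub = LIMSEQ_subseq_LIMSEQ[OF _ s, unfolded comp_def]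
    have v_lim: "(\<lambda>j. u (s j) i) \<longlonglongrightarrow> v i" for i using s1(2)[of i] by (simp add: s_def)
    have "horizon_nonpos (k + d) g (vappend k w v)"
    proof (rule horizon_nonpos_limit[where v = "\<lambda>j. vappend k (w' (s j)) (u (s j))"])
      show "(\<lambda>j. l (s j)) \<longlonglongrightarrow> 0" by (rule sub[OF l0])
      show "(\<lambda>j. 1 / real (Suc (s j))) \<longlonglongrightarrow> 0" by (rule sub[OF inverse_Suc_tendsto_0])
      show "(\<lambda>j. vappend k (w' (s j)) (u (s j)) i) \<longlonglongrightarrow> vappend k w v i" for i
        using sub[OF w'_lim] v_lim by (simp add: vappend_def)
      show "\<forall>\<^sub>F j in sequentially. 0 < l (s j) \<and> vappend k (w' (s j)) (u (s j)) \<in> Rvec (k + d) \<and>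
          ereal (l (s j)) * g (\<lambda>i. vappend k (w' (s j)) (u (s j)) i / l (s j)) < ereal (1 / real (Suc (s j)))"
        using l(1) g by (intro always_eventually allI) (simp add: scale vappend_in_Rvec w'_Rvec u)
    qed
    then show ?thesis using Rvec_lim[of "\<lambda>j. u (s j)" v] v_lim u by blast
  next
    case False
    then have ev: "\<forall>\<^sub>F j in sequentially. R < r j" for R
      by (simp add: not_frequently cofinite_eq_sequentially not_le)
    then have r_top: "filterlim r at_top sequentially" by (simp add: filterlim_at_top_dense)
    then have ir: "(\<lambda>j. inverse (r j)) \<longlonglongrightarrow> 0" by (rule tendsto_inverse_0_at_top)
    define z where "z j i = u j i * inverse (r j)" for j i
    have "\<bar>z j i\<bar> \<le> 1" for j i
    proof -
      have "\<bar>z j i\<bar> = \<bar>u j i\<bar> / r j"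
        by (simp add: z_def abs_mult r_def divide_inverse L2_set_nonneg)
      also have "\<dots> \<le> 1" using u_le[of j i] by (auto simp: divide_le_eq_1)
      finally show ?thesis .
    qed
    then obtain s v where s: "strict_mono s" and v_lim: "\<And>i. (\<lambda>j. z (s j) i) \<longlonglongrightarrow> v i"
      by (rule bounded_coordinates_subseq[of z]) blast
    note sub = LIMSEQ_subseq_LIMSEQ[OF _ s, unfolded comp_def]
    have ev_s: "\<forall>\<^sub>F j in sequentially. R < r (s j)" for R
      using ev[of R] s by (rule eventually_subseq[rotated])
    have "v \<in> Rvec d" using u by (intro Rvec_lim[OF v_lim]) (simp add: z_def Rvec_iff)
    have "(\<lambda>j. L2_set (z (s j)) {..<d}) \<longlonglongrightarrow> L2_set v {..<d}"
      unfolding L2_set_def by (intro tendsto_intros v_lim)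
    moreover have "\<forall>\<^sub>F j in sequentially. L2_set (z (s j)) {..<d} = 1"
      using ev_s[of 0]
    proof eventually_elim
      case (elim j)
      have "L2_set (z (s j)) {..<d} = r (s j) * inverse (r (s j))"
        unfolding z_def r_def by (rule L2_set_left_distrib[symmetric]) (simp add: L2_set_nonneg)
      then show ?case using elim by simp
    qed
    ultimately have "(\<lambda>j. 1 :: real) \<longlonglongrightarrow> L2_set v {..<d}" by (rule Lim_transform_eventually)
    then have "L2_set v {..<d} = 1" by (simp add: LIMSEQ_const_iff)
    then have "v \<noteq> (\<lambda>_. 0)" by (auto simp: L2_set_def)
    \<comment> \<open>Dividing vector and scalar by the same \<open>r\<close> leaves the argument of
      \<open>g\<close> unchanged and divides its scaled value by \<open>r\<close>, while
      \<open>w' / r\<close> tends to 0.\<close>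
    moreover have "horizon_nonpos (k + d) g (vappend k (\<lambda>_. 0) v)"
    proof (rule horizon_nonpos_limit[where v = "\<lambda>j i. vappend k (w' (s j)) (u (s j)) i * inverse (r (s j))"])
      show "(\<lambda>j. l (s j) * inverse (r (s j))) \<longlonglongrightarrow> 0"
        using tendsto_mult[OF sub[OF l0] sub[OF ir]] by simp
      show "(\<lambda>j. 1 / real (Suc (s j)) * inverse (r (s j))) \<longlonglongrightarrow> 0"
        using tendsto_mult[OF sub[OF inverse_Suc_tendsto_0] sub[OF ir]] by simp
      show "(\<lambda>j. vappend k (w' (s j)) (u (s j)) i * inverse (r (s j))) \<longlonglongrightarrow> vappend k (\<lambda>_. 0) v i" for i
        using tendsto_mult[OF sub[OF w'_lim] sub[OF ir]] v_lim by (simp add: vappend_def z_def)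
      show "\<forall>\<^sub>F j in sequentially. 0 < l (s j) * inverse (r (s j)) \<and>
          (\<lambda>i. vappend k (w' (s j)) (u (s j)) i * inverse (r (s j))) \<in> Rvec (k + d) \<and>
          ereal (l (s j) * inverse (r (s j))) *
            g (\<lambda>i. vappend k (w' (s j)) (u (s j)) i * inverse (r (s j)) / (l (s j) * inverse (r (s j))))
          < ereal (1 / real (Suc (s j)) * inverse (r (s j)))"
        using ev_s[of 0]
      proof eventually_elim
        case (elim j)
        have "ereal (inverse (r (s j))) * (ereal (l (s j)) * g (vappend k (\<lambda>i. w' (s j) i / l (s j)) (y (s j))))
            < ereal (inverse (r (s j))) * ereal (1 / real (Suc (s j)))"
          by (rule ereal_mult_strict_left_mono[OF g]) (use elim in auto)
        moreover have "(\<lambda>i. vappend k (w' (s j)) (u (s j)) i * inverse (r (s j)) / (l (s j) * inverse (r (s j)))) =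
            vappend k (\<lambda>i. w' (s j) i / l (s j)) (y (s j))"
          using elim by (simp add: scale)
        moreover have "vappend k (w' (s j)) (u (s j)) \<in> Rvec (k + d)"
          by (intro vappend_in_Rvec w'_Rvec u)
        ultimately show ?case using elim l(1)[of "s j"]
          by (simp add: Rvec_iff mult.assoc[symmetric] mult.commute)
      qed
    qed
    ultimately show ?thesis using pos \<open>v \<in> Rvec d\<close> by blast
  qed
qed

section \<open>Passing nonpositive horizon values from a conditional integrand to the integrand
  before conditioning\<close>

section \<open>Conditional integrands\<close>

text \<open>
  The horizon involves an uncountable infimum, so instead of its sublevel sets the selection theorem is
  applied to the space of sequences realising the infimum.
\<close>

lemma horizon_selection:
  assumes N: "finite_measure N"
    and g: "(\<lambda>(x, \<omega>). g x \<omega>) \<in> borel_measurable (borel_Rvec (k + d) \<Otimes>\<^sub>M N)"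
    and w: "w \<in> N \<rightarrow>\<^sub>M borel_Rvec k" and Q: "Q \<in> sets borel"
  obtains B y l v where "B \<in> sets N" "y \<in> N \<rightarrow>\<^sub>M borel_Rvec d"
    "\<And>j. l j \<in> borel_measurable N" "\<And>j. v j \<in> N \<rightarrow>\<^sub>M borel_Rvec (k + d)"
    "AE \<omega> in N. (\<exists>y\<in>Rvec d \<inter> Q. horizon_nonpos (k + d) (\<lambda>x. g x \<omega>) (vappend k (w \<omega>) y)) \<longrightarrow> \<omega> \<in> B"
    "\<And>\<omega>. \<omega> \<in> B \<Longrightarrow> y \<omega> \<in> Q"
    "\<And>\<omega> j. \<omega> \<in> B \<Longrightarrow> 0 < l j \<omega> \<and> l j \<omega> < 1 / real (Suc j) \<and>
       v j \<omega> \<in> cball_Rvec (k + d) (vappend k (w \<omega>) (y \<omega>)) (1 / real (Suc j)) \<and>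
       ereal (l j \<omega>) * g (\<lambda>i. v j \<omega> i / l j \<omega>) \<omega> < ereal (1 / real (Suc j))"
proof -
  \<comment> \<open>Truncation makes every point of the code space denote vectors of the right
    dimension, so \<open>A\<close> needs no condition on dimensions.\<close>
  define trunc where "trunc m x = (\<lambda>i. if i < m then x i else 0)" for m and x :: "nat \<Rightarrow> real"
  have trunc_Rvec: "trunc m x \<in> Rvec m" for m x by (simp add: trunc_def Rvec_iff)
  have trunc_id: "trunc m x = x" if "x \<in> Rvec m" for m x
    using that by (auto simp: trunc_def Rvec_iff fun_eq_iff)
  \<comment> \<open>A point \<open>z\<close> of the Polish space \<open>nat \<Rightarrow> nat \<Rightarrow> real\<close> encodes the direction, the scalars and the vectors.\<close>
  define Y where "Y z = trunc d (z 0)" for z :: "nat \<Rightarrow> nat \<Rightarrow> real"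
  define L where "L j z = z 1 j" for j :: nat and z :: "nat \<Rightarrow> nat \<Rightarrow> real"
  define V where "V j z = trunc (k + d) (z (j + 2))" for j and z :: "nat \<Rightarrow> nat \<Rightarrow> real"
  have Y_Rvec: "Y z \<in> Rvec d" and V_Rvec: "V j z \<in> Rvec (k + d)" for z j
    by (simp_all add: Y_def V_def trunc_Rvec)
  have coord: "(\<lambda>z. z a b) \<in> borel_measurable borel" for a b :: nat
    using measurable_product_then_coordinatewise[OF measurable_product_coordinates, of a b]
    by simp
  have Y_coord: "(\<lambda>z. Y z i) \<in> borel_measurable borel" and L: "L j \<in> borel_measurable borel"
    and V_coord: "(\<lambda>z. V j z i) \<in> borel_measurable borel" for i j
    unfolding Y_def L_def V_def trunc_def by (cases "i < d"; cases "i < k + d"; simp add: coord)+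
  have Y: "Y \<in> borel \<rightarrow>\<^sub>M borel"
    using measurable_coordinatewise_then_product[of Y borel] Y_coord by simp
  note [measurable] = L V_coord Y_coord Y Q
  have w_coord[measurable]: "(\<lambda>\<omega>. w \<omega> i) \<in> borel_measurable N" for i
    using w by (simp add: measurable_borel_Rvec_iff)
  have [measurable]: "(\<lambda>p. vappend k (w (snd p)) (Y (fst p)) i) \<in> borel_measurable (borel \<Otimes>\<^sub>M N)" for i
    unfolding vappend_def by (cases "i < k"; simp; measurable)
  have [measurable]: "(\<lambda>p. g (\<lambda>i. V j (fst p) i / L j (fst p)) (snd p)) \<in> borel_measurable (borel \<Otimes>\<^sub>M N)" for j
  proof -
    have "(\<lambda>p i. V j (fst p) i / L j (fst p)) \<in> borel \<Otimes>\<^sub>M N \<rightarrow>\<^sub>M borel_Rvec (k + d)"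
      unfolding measurable_borel_Rvec_iff
    proof (intro conjI allI)
      show "(\<lambda>p i. V j (fst p) i / L j (fst p)) \<in> space (borel \<Otimes>\<^sub>M N) \<rightarrow> Rvec (k + d)"
        using V_Rvec by (auto simp: Rvec_iff)
    qed measurable
    then have "(\<lambda>p. (\<lambda>i. V j (fst p) i / L j (fst p), snd p)) \<in> borel \<Otimes>\<^sub>M N \<rightarrow>\<^sub>M borel_Rvec (k + d) \<Otimes>\<^sub>M N"
      by (intro measurable_Pair measurable_snd)
    from measurable_compose[OF this g] show ?thesis by simp
  qed
  define A where "A = {p \<in> space (borel \<Otimes>\<^sub>M N). Y (fst p) \<in> Q \<and> (\<forall>j. 0 < L j (fst p) \<and> L j (fst p) < 1 / real (Suc j) \<and>
     L2_set (\<lambda>i. V j (fst p) i - vappend k (w (snd p)) (Y (fst p)) i) {..<k + d} \<le> 1 / real (Suc j) \<and>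
     ereal (L j (fst p)) * g (\<lambda>i. V j (fst p) i / L j (fst p)) (snd p) < ereal (1 / real (Suc j)))}"
  have A: "A \<in> sets (borel \<Otimes>\<^sub>M N)"
    unfolding A_def L2_set_def by measurable
  obtain f where f[measurable]: "f \<in> N \<rightarrow>\<^sub>M borel"
    and sel: "AE \<omega> in N. (\<exists>z. (z, \<omega>) \<in> A) \<longrightarrow> (f \<omega>, \<omega>) \<in> A"
    by (rule measurable_selection[OF N A]) blast
  \<comment> \<open>\<open>B\<close> is the set where the selected code is valid, so the
    inequalities hold at every point of \<open>B\<close>. The exceptional null set only affects what
    \<open>B\<close> covers.\<close>
  define B where "B = {\<omega> \<in> space N. (f \<omega>, \<omega>) \<in> A}"
  have A_ne: "\<exists>z. (z, \<omega>) \<in> A" if y: "y \<in> Rvec d \<inter> Q" and \<omega>: "\<omega> \<in> space N"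
    and hn: "horizon_nonpos (k + d) (\<lambda>x. g x \<omega>) (vappend k (w \<omega>) y)" for y \<omega>
  proof -
    have "\<forall>j. \<exists>l v. 0 < l \<and> l < 1 / real (Suc j) \<and>
        v \<in> cball_Rvec (k + d) (vappend k (w \<omega>) y) (1 / real (Suc j)) \<and>
        ereal l * g (\<lambda>i. v i / l) \<omega> < ereal (1 / real (Suc j))"
      using hn unfolding horizon_nonpos_def by simp
    then obtain l v where lv: "\<And>j. 0 < l j \<and> l j < 1 / real (Suc j) \<and>
        v j \<in> cball_Rvec (k + d) (vappend k (w \<omega>) y) (1 / real (Suc j)) \<and>
        ereal (l j) * g (\<lambda>i. v j i / l j) \<omega> < ereal (1 / real (Suc j))"
      by metis
    define z where "z a = (if a = 0 then y else if a = 1 then l else v (a - 2))" for a :: nat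
    have z: "Y z = y" "L j z = l j" "V j z = v j" for j
      using y lv[of j] by (auto simp: Y_def L_def V_def z_def trunc_id cball_Rvec_def)
    have "(z, \<omega>) \<in> A"
      using y lv \<omega> by (auto simp: A_def z space_pair_measure cball_Rvec_def)
    then show ?thesis by (intro exI[where x = z])
  qed
  show thesis
  proof (rule that[of B "\<lambda>\<omega>. Y (f \<omega>)" "\<lambda>j \<omega>. L j (f \<omega>)" "\<lambda>j \<omega>. V j (f \<omega>)"])
    have "(\<lambda>\<omega>. (f \<omega>, \<omega>)) \<in> N \<rightarrow>\<^sub>M borel \<Otimes>\<^sub>M N" by measurable
    from measurable_sets[OF this A] show "B \<in> sets N"
      by (simp add: B_def vimage_def Int_def conj_commute)
    show "(\<lambda>\<omega>. Y (f \<omega>)) \<in> N \<rightarrow>\<^sub>M borel_Rvec d"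
      unfolding measurable_borel_Rvec_iff using Y_Rvec measurable_compose[OF f Y_coord] by auto
    show "(\<lambda>\<omega>. V j (f \<omega>)) \<in> N \<rightarrow>\<^sub>M borel_Rvec (k + d)" for j
      unfolding measurable_borel_Rvec_iff using V_Rvec measurable_compose[OF f V_coord] by auto
    show "(\<lambda>\<omega>. L j (f \<omega>)) \<in> borel_measurable N" for j
      by (rule measurable_compose[OF f L])
    show "AE \<omega> in N. (\<exists>y\<in>Rvec d \<inter> Q. horizon_nonpos (k + d) (\<lambda>x. g x \<omega>) (vappend k (w \<omega>) y)) \<longrightarrow> \<omega> \<in> B"
      using sel AE_space
    proof eventually_elim
      case (elim \<omega>)
      then show ?case using A_ne[of _ \<omega>] by (auto simp: B_def)
    qed
    show "Y (f \<omega>) \<in> Q" if "\<omega> \<in> B" for \<omega>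
      using that by (simp add: B_def A_def)
    show "0 < L j (f \<omega>) \<and> L j (f \<omega>) < 1 / real (Suc j) \<and>
       V j (f \<omega>) \<in> cball_Rvec (k + d) (vappend k (w \<omega>) (Y (f \<omega>))) (1 / real (Suc j)) \<and>
       ereal (L j (f \<omega>)) * g (\<lambda>i. V j (f \<omega>) i / L j (f \<omega>)) \<omega> < ereal (1 / real (Suc j))"
      if "\<omega> \<in> B" for \<omega> j
      using that V_Rvec by (simp add: B_def A_def cball_Rvec_def)
  qed
qed

text \<open>Moving the negative part to the other side leaves only nonnegative terms, which can be
  integrated in \<open>ennreal\<close>. As \<open>Q\<close> is finite,
  \<open>P = \<infinity>\<close> would make the bounded product infinite. Since
  \<open>ennreal\<close> truncates a negative \<open>e\<close>, the proof passes through
  \<open>max e 0\<close>.\<close>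

lemma positive_part_bound:
  fixes P Q :: ennreal
  assumes "0 < l" "Q < \<infinity>" "ereal l * (enn2ereal P - enn2ereal Q) < ereal e"
  shows "ennreal l * P \<le> ennreal e + ennreal l * Q"
proof -
  obtain q where q: "Q = ennreal q" "q \<ge> 0" using assms(2) by (cases Q) auto
  show ?thesis
  proof (cases P)
    case (real p)
    then have "l * p - l * q < e" using assms q by (simp add: right_diff_distrib)
    then have "ennreal (l * p) \<le> ennreal (max e 0 + l * q)" by (intro ennreal_leI) (auto simp: max_def)
    also have "\<dots> = ennreal (max e 0) + ennreal (l * q)" using q assms(1) by (intro ennreal_plus) auto
    also have "ennreal (max e 0) = ennreal e" by (auto simp: max_def ennreal_neg)
    finally show ?thesis using assms(1) q real by (simp add: ennreal_mult)
  next
    case top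
    then show ?thesis using assms q by simp
  qed
qed

text \<open>Fatou's lemma is applied to positive parts only. The negative parts are dominated by
  \<open>\<bar>m\<bar>\<close> and enter with the factor \<open>l j < 1 / Suc j\<close>, so the
  integrals over \<open>B\<close> of \<open>l j\<close> times the positive part tend to 0.\<close>

lemma horizon_nonpos_conditional:
  assumes M: "prob_space M" and sub: "subalgebra M G" and cond: "is_cond_integrand M G k g g'"
    and B: "B \<in> sets G" and l: "\<And>j. l j \<in> borel_measurable G"
    and v: "\<And>j. v j \<in> G \<rightarrow>\<^sub>M borel_Rvec k"
    and seq: "\<And>\<omega> j. \<omega> \<in> B \<Longrightarrow> 0 < l j \<omega> \<and> l j \<omega> < 1 / real (Suc j) \<and>
       v j \<omega> \<in> cball_Rvec k (w \<omega>) (1 / real (Suc j)) \<and>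
       ereal (l j \<omega>) * g' (\<lambda>i. v j \<omega> i / l j \<omega>) \<omega> < ereal (1 / real (Suc j))"
  shows "AE \<omega> in M. \<omega> \<in> B \<longrightarrow> horizon_nonpos k (\<lambda>x. g x \<omega>) (w \<omega>)"
proof -
  interpret prob_space M by fact
  interpret finite_measure_subalgebra M G
    by unfold_locales (fact sub)
  obtain m where m: "integrable M m" "AE \<omega> in M. \<forall>x\<in>Rvec k. ereal (m \<omega>) \<le> g x \<omega>"
    using cond by (auto simp: is_cond_integrand_def bounded_below_by_def)
  have [measurable]: "m \<in> borel_measurable M" using m(1) by simp
  have B_M[measurable]: "B \<in> sets M" using B sub by (auto simp: subalgebra_def)
  define x where "x j \<omega> = (\<lambda>i. v j \<omega> i / l j \<omega>)" for j \<omega>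
  \<comment> \<open>Measurability in \<open>G\<close> is what allows the defining identity of the
    conditional integrand to be used at \<open>x j\<close>.\<close>
  have x: "x j \<in> G \<rightarrow>\<^sub>M borel_Rvec k" for j
  proof -
    have [measurable]: "(\<lambda>\<omega>. v j \<omega> i) \<in> borel_measurable G" for i
      using v[of j] by (simp add: measurable_borel_Rvec_iff)
    have "x j \<in> space G \<rightarrow> Rvec k"
      using v[of j] by (auto simp: measurable_borel_Rvec_iff x_def Rvec_iff Pi_iff)
    moreover have "(\<lambda>\<omega>. x j \<omega> i) \<in> borel_measurable G" for i
      using l unfolding x_def by measurable
    ultimately show ?thesis by (simp add: measurable_borel_Rvec_iff)
  qed
  define f where "f j \<omega> = g (x j \<omega>) \<omega>" for j \<omega>
  have f[measurable]: "f j \<in> borel_measurable M" for j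
  proof -
    have "(\<lambda>(x, \<omega>). g x \<omega>) \<in> borel_measurable (borel_Rvec k \<Otimes>\<^sub>M M)"
      using cond by (simp add: is_cond_integrand_def normal_integrand_def)
    from measurable_compose[OF measurable_Pair[OF measurable_from_subalg[OF sub x[of j]] measurable_ident] this]
    show ?thesis by (simp add: f_def[abs_def])
  qed
  define P where "P j = nn_cond_exp M G (\<lambda>\<omega>. e2ennreal (f j \<omega>))" for j
  define Q where "Q j = nn_cond_exp M G (\<lambda>\<omega>. e2ennreal (- f j \<omega>))" for j
  define C where "C = nn_cond_exp M G (\<lambda>\<omega>. ennreal \<bar>m \<omega>\<bar>)"
  have [measurable]: "P j \<in> borel_measurable M" "C \<in> borel_measurable M" for j
    unfolding P_def C_def by simp_all
  have g'_eq: "AE \<omega> in M. \<forall>j. g' (x j \<omega>) \<omega> = enn2ereal (P j \<omega>) - enn2ereal (Q j \<omega>)"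
    unfolding AE_all_countable
    using cond x by (auto simp: is_cond_integrand_def ereal_cond_exp_def f_def P_def Q_def)
  have x_Rvec: "x j \<omega> \<in> Rvec k" if "\<omega> \<in> space M" for j \<omega>
    using x[of j] that sub by (auto simp: measurable_borel_Rvec_iff subalgebra_def)
  have Q_le: "AE \<omega> in M. \<forall>j. Q j \<omega> \<le> C \<omega>"
    unfolding AE_all_countable Q_def C_def
  proof (intro allI nn_cond_exp_mono)
    show "AE \<omega> in M. e2ennreal (- f j \<omega>) \<le> ennreal \<bar>m \<omega>\<bar>" for j
      using m(2) AE_space
    proof eventually_elim
      case (elim \<omega>)
      then have "ereal (m \<omega>) \<le> f j \<omega>" using x_Rvec by (auto simp: f_def)
      then have "- f j \<omega> \<le> ereal \<bar>m \<omega>\<bar>" by (cases "f j \<omega>") auto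
      then have "e2ennreal (- f j \<omega>) \<le> e2ennreal (ereal \<bar>m \<omega>\<bar>)" by (rule e2ennreal_mono)
      then show ?case by simp
    qed
  qed measurable
  define c where "c = (\<integral>\<^sup>+ \<omega>. ennreal \<bar>m \<omega>\<bar> \<partial>M)"
  have int_C: "(\<integral>\<^sup>+ \<omega>. C \<omega> \<partial>M) = c"
    using nn_cond_exp_intg[of "\<lambda>_. 1" "\<lambda>\<omega>. ennreal \<bar>m \<omega>\<bar>"] by (simp add: C_def c_def)
  have c_fin: "c < \<infinity>"
    using m(1) by (simp add: c_def integrable_iff_bounded)
  have C_fin: "AE \<omega> in M. C \<omega> \<noteq> \<infinity>"
    by (rule nn_integral_noteq_infinite) (use int_C c_fin in auto)
  \<comment> \<open>The indicator confines the estimate to \<open>B\<close>, where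
    \<open>l j\<close> is known to be positive. Being \<open>G\<close>-measurable, the factor passes
    through the conditional expectation.\<close>
  define I where "I j \<omega> = indicator B \<omega> * ennreal (l j \<omega>)" for j \<omega>
  have I_G[measurable]: "I j \<in> borel_measurable G" for j
    using l[of j] B unfolding I_def by measurable
  have I_M[measurable]: "I j \<in> borel_measurable M" for j
    by (rule measurable_from_subalg[OF sub I_G])
  \<comment> \<open>In \<open>1 + c\<close>, the 1 stems from the tolerance \<open>1 / Suc j\<close>
    and \<open>c\<close> from the negative part.\<close>
  have bound: "(\<integral>\<^sup>+ \<omega>. I j \<omega> * e2ennreal (f j \<omega>) \<partial>M) \<le> ennreal (1 / real (Suc j)) * (1 + c)" for j
  proof -
    have "(\<integral>\<^sup>+ \<omega>. I j \<omega> * e2ennreal (f j \<omega>) \<partial>M) = (\<integral>\<^sup>+ \<omega>. I j \<omega> * P j \<omega> \<partial>M)"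
      unfolding P_def by (rule nn_cond_exp_intg[symmetric]) measurable
    also have "\<dots> \<le> (\<integral>\<^sup>+ \<omega>. ennreal (1 / real (Suc j)) * (1 + C \<omega>) \<partial>M)"
    proof (rule nn_integral_mono_AE)
      show "AE \<omega> in M. I j \<omega> * P j \<omega> \<le> ennreal (1 / real (Suc j)) * (1 + C \<omega>)"
        using g'_eq Q_le C_fin
      proof eventually_elim
        case (elim \<omega>)
        show ?case
        proof (cases "\<omega> \<in> B")
          case True
          have "ennreal (l j \<omega>) * P j \<omega> \<le> ennreal (1 / real (Suc j)) + ennreal (l j \<omega>) * Q j \<omega>"
          proof (rule positive_part_bound)
            show "Q j \<omega> < \<infinity>" 
              using elim le_less_trans[of "Q j \<omega>" "C \<omega>" "\<infinity>"] by (simp add: less_top)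
            show "ereal (l j \<omega>) * (enn2ereal (P j \<omega>) - enn2ereal (Q j \<omega>)) < ereal (1 / real (Suc j))"
              using seq[OF True, of j] elim(1) by (simp add: x_def)
          qed (use seq[OF True] in auto)
          also have "\<dots> \<le> ennreal (1 / real (Suc j)) + ennreal (1 / real (Suc j)) * C \<omega>"
            using seq[OF True, of j] elim(2) by (intro add_left_mono mult_mono ennreal_leI) auto
          finally show ?thesis using True by (simp add: I_def distrib_left)
        qed (simp add: I_def)
      qed
    qed
    also have "\<dots> = ennreal (1 / real (Suc j)) * (1 + c)"
      by (simp add: nn_integral_cmult nn_integral_add int_C emeasure_space_1)
    finally show ?thesis .
  qed
  have "(\<lambda>j. ennreal (1 / real (Suc j)) * (1 + c)) \<longlonglongrightarrow> ennreal 0 * (1 + c)"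
    by (intro tendsto_mult_ennreal tendsto_const tendsto_ennrealI inverse_Suc_tendsto_0) (use c_fin in auto)
  then have lim0: "liminf (\<lambda>j. ennreal (1 / real (Suc j)) * (1 + c)) = 0"
    by (simp add: lim_imp_Liminf)
  have "(\<integral>\<^sup>+ \<omega>. liminf (\<lambda>j. I j \<omega> * e2ennreal (f j \<omega>)) \<partial>M) \<le> liminf (\<lambda>j. \<integral>\<^sup>+ \<omega>. I j \<omega> * e2ennreal (f j \<omega>) \<partial>M)"
    by (rule nn_integral_liminf) measurable
  also have "\<dots> \<le> liminf (\<lambda>j. ennreal (1 / real (Suc j)) * (1 + c))"
    by (intro Liminf_mono always_eventually allI bound)
  finally have "(\<integral>\<^sup>+ \<omega>. liminf (\<lambda>j. I j \<omega> * e2ennreal (f j \<omega>)) \<partial>M) = 0"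
    by (simp only: lim0 le_zero_eq)
  then have "AE \<omega> in M. liminf (\<lambda>j. I j \<omega> * e2ennreal (f j \<omega>)) = 0"
    by (subst (asm) nn_integral_0_iff_AE) measurable
  then show ?thesis
  proof eventually_elim
    case (elim \<omega>)
    show ?case
    proof
      assume \<omega>: "\<omega> \<in> B"
      show "horizon_nonpos k (\<lambda>x. g x \<omega>) (w \<omega>)"
        unfolding horizon_nonpos_def
      proof (intro allI impI)
        fix e :: real assume e: "e > 0"
        obtain n where n: "1 / real (Suc n) < e" using e by (rule nat_approx_posE)
        \<comment> \<open>Every tail infimum is at most the liminf, which is 0, so some
          \<open>j \<ge> n\<close> has a small scaled positive part; \<open>j \<ge> n\<close> also
          makes scalar and radius small enough.\<close>
        have "(INF j\<in>{n..}. I j \<omega> * e2ennreal (f j \<omega>)) \<le> liminf (\<lambda>j. I j \<omega> * e2ennreal (f j \<omega>))"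
          unfolding liminf_SUP_INF by (rule SUP_upper) simp
        also have "\<dots> < ennreal e" using elim e by simp
        finally obtain j where j: "j \<ge> n" "I j \<omega> * e2ennreal (f j \<omega>) < ennreal e"
          unfolding INF_less_iff by auto
        have "1 / real (Suc j) \<le> 1 / real (Suc n)" using j(1) by (simp add: frac_le)
        then have je: "1 / real (Suc j) < e" using n by simp
        \<comment> \<open>Only the positive part is controlled, but a nonpositive value satisfies
          the bound anyway.\<close>
        have "ereal (l j \<omega>) * f j \<omega> < ereal e"
        proof (cases "f j \<omega>")
          case (real r)
          show ?thesis
          proof (cases "r \<le> 0")
            case True
            then show ?thesis using real seq[OF \<omega>, of j] e
              by (simp add: mult_nonneg_nonpos less_imp_le order_le_less_trans[of "l j \<omega> * r" 0 e])
          next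
            case False
            then have "ennreal (l j \<omega> * r) < ennreal e"
              using j(2) \<omega> seq[OF \<omega>, of j] real by (simp add: I_def ennreal_mult)
            moreover have "0 \<le> l j \<omega> * r" using False seq[OF \<omega>, of j] by simp
            ultimately show ?thesis using real by (simp add: ennreal_less_iff)
          qed
        next
          case PInf
          then show ?thesis using j(2) \<omega> seq[OF \<omega>, of j] by (simp add: I_def ennreal_mult_top)
        next
          case MInf
          then show ?thesis using seq[OF \<omega>, of j] by simp
        qed
        then show "\<exists>l w'. 0 < l \<and> l < e \<and> w' \<in> cball_Rvec k (w \<omega>) e \<and> ereal l * g (\<lambda>i. w' i / l) \<omega> < ereal e"
          using seq[OF \<omega>, of j] je cball_Rvec_mono[OF less_imp_le[OF je], of k "w \<omega>"]
          by (intro exI[of _ "l j \<omega>"] exI[of _ "v j \<omega>"]) (auto simp: f_def x_def)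
      qed
    qed
  qed
qed

section \<open>Stagewise selections joined into an adapted process\<close>

section \<open>Dynamic programming\<close>

text \<open>Selection followed by Fatou: directions existing outcome by outcome for
  \<open>g'\<close> become one \<open>G\<close>-measurable direction for \<open>g\<close>. The set
  \<open>Q\<close> excludes 0 at the first stage and is everything later.\<close>

lemma stage_selection:
  assumes M: "prob_space M" and sub: "subalgebra M G" and cond: "is_cond_integrand M G (k + d) g g'"
    and w: "w \<in> G \<rightarrow>\<^sub>M borel_Rvec k" and Q: "Q \<in> sets borel"
  obtains B y where "B \<in> sets G" "y \<in> G \<rightarrow>\<^sub>M borel_Rvec d"
    "AE \<omega> in M. (\<exists>y\<in>Rvec d \<inter> Q. horizon_nonpos (k + d) (\<lambda>x. g' x \<omega>) (vappend k (w \<omega>) y)) \<longrightarrow> \<omega> \<in> B"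
    "\<And>\<omega>. \<omega> \<in> B \<Longrightarrow> y \<omega> \<in> Q"
    "AE \<omega> in M. \<omega> \<in> B \<longrightarrow> horizon_nonpos (k + d) (\<lambda>x. g x \<omega>) (vappend k (w \<omega>) (y \<omega>))"
proof -
  interpret prob_space M by fact
  \<comment> \<open>Selecting in the restriction of \<open>M\<close> to \<open>G\<close> makes the
    result \<open>G\<close>-measurable, and null sets of the restriction are null for
    \<open>M\<close>.\<close>
  let ?N = "restr_to_subalg M G"
  have N: "finite_measure ?N"
    by (rule finite_measure_restr_to_subalg[OF sub]) unfold_locales
  have sets_N[measurable_cong]: "sets ?N = sets G" by (rule sets_restr_to_subalg[OF sub])
  have meas: "measurable ?N X = measurable G X" for X :: "'c measure"
    by (rule measurable_cong_sets[OF sets_N refl])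
  have "(\<lambda>(x, \<omega>). g' x \<omega>) \<in> borel_measurable (borel_Rvec (k + d) \<Otimes>\<^sub>M G)"
    using cond by (simp add: is_cond_integrand_def normal_integrand_def)
  also have "borel_measurable (borel_Rvec (k + d) \<Otimes>\<^sub>M G) = borel_measurable (borel_Rvec (k + d) \<Otimes>\<^sub>M ?N)"
    by (intro measurable_cong_sets sets_pair_measure_cong refl sets_N[symmetric])
  finally have g': "(\<lambda>(x, \<omega>). g' x \<omega>) \<in> borel_measurable (borel_Rvec (k + d) \<Otimes>\<^sub>M ?N)" .
  have w': "w \<in> ?N \<rightarrow>\<^sub>M borel_Rvec k" using w by (simp add: meas)
  obtain B y l v where B: "B \<in> sets ?N" and y: "y \<in> ?N \<rightarrow>\<^sub>M borel_Rvec d"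
    and l: "\<And>j. l j \<in> borel_measurable ?N" and v: "\<And>j. v j \<in> ?N \<rightarrow>\<^sub>M borel_Rvec (k + d)"
    and AE_B: "AE \<omega> in ?N. (\<exists>y\<in>Rvec d \<inter> Q. horizon_nonpos (k + d) (\<lambda>x. g' x \<omega>) (vappend k (w \<omega>) y)) \<longrightarrow> \<omega> \<in> B"
    and yQ: "\<And>\<omega>. \<omega> \<in> B \<Longrightarrow> y \<omega> \<in> Q"
    and seq: "\<And>\<omega> j. \<omega> \<in> B \<Longrightarrow> 0 < l j \<omega> \<and> l j \<omega> < 1 / real (Suc j) \<and>
       v j \<omega> \<in> cball_Rvec (k + d) (vappend k (w \<omega>) (y \<omega>)) (1 / real (Suc j)) \<and>
       ereal (l j \<omega>) * g' (\<lambda>i. v j \<omega> i / l j \<omega>) \<omega> < ereal (1 / real (Suc j))"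
    by (rule horizon_selection[OF N g' w' Q]) blast
  show thesis
  proof (rule that[of B y])
    show "AE \<omega> in M. \<omega> \<in> B \<longrightarrow> horizon_nonpos (k + d) (\<lambda>x. g x \<omega>) (vappend k (w \<omega>) (y \<omega>))"
      by (rule horizon_nonpos_conditional[OF M sub cond, where l = l and v = v])
        (use B l v seq in \<open>simp_all add: meas sets_N\<close>)
    show "AE \<omega> in M. (\<exists>y\<in>Rvec d \<inter> Q. horizon_nonpos (k + d) (\<lambda>x. g' x \<omega>) (vappend k (w \<omega>) y)) \<longrightarrow> \<omega> \<in> B"
      by (rule AE_restr_to_subalg[OF sub AE_B])
  qed (use B y yQ in \<open>simp_all add: meas sets_N\<close>)
qed

lemma vappend_measurable:
  assumes "a \<in> G \<rightarrow>\<^sub>M borel_Rvec k" "b \<in> G \<rightarrow>\<^sub>M borel_Rvec d"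
  shows "(\<lambda>\<omega>. vappend k (a \<omega>) (b \<omega>)) \<in> G \<rightarrow>\<^sub>M borel_Rvec (k + d)"
proof -
  have "(\<lambda>\<omega>. vappend k (a \<omega>) (b \<omega>) i) \<in> borel_measurable G" for i
    using assms by (cases "i < k") (simp_all add: measurable_borel_Rvec_iff vappend_def)
  then show ?thesis
    using assms vappend_in_Rvec by (auto simp: measurable_borel_Rvec_iff Pi_iff)
qed

lemma zero_measurable: "(\<lambda>_ _. 0) \<in> G \<rightarrow>\<^sub>M borel_Rvec k"
  by (auto simp: measurable_borel_Rvec_iff Rvec_iff)

lemma offset_Suc: "offset n (Suc t) = offset n t + n t"
  by (simp add: offset_def)

lemma history_measurable:
  assumes "\<And>r. r < t \<Longrightarrow> x r \<in> G \<rightarrow>\<^sub>M borel_Rvec (n r)"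
  shows "history n x t \<in> G \<rightarrow>\<^sub>M borel_Rvec (offset n t)"
  using assms
proof (induction t)
  case 0
  then show ?case using zero_measurable[of G "offset n 0"] by (simp add: history.simps(1)[abs_def])
next
  case (Suc t)
  have "(\<lambda>\<omega>. vappend (offset n t) (history n x t \<omega>) (x t \<omega>)) \<in> G \<rightarrow>\<^sub>M borel_Rvec (offset n t + n t)"
    by (rule vappend_measurable) (use Suc in simp_all)
  then show ?case by (simp add: offset_Suc history.simps(2)[abs_def])
qed

lemma history_cong:
  "(\<And>r. r < t \<Longrightarrow> x r \<omega> = x' r \<omega>) \<Longrightarrow> history n x t \<omega> = history n x' t \<omega>"
  by (induction t) auto

lemma history_zero:
  "(\<And>r. r < t \<Longrightarrow> x r \<omega> = (\<lambda>_. 0)) \<Longrightarrow> history n x t \<omega> = (\<lambda>_. 0)"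
  by (induction t) (auto simp: vappend_def)

text \<open>A forward construction serves one step of a backward induction. A nonzero direction at
  \<open>t\<close> is prolonged stage by stage up to \<open>T\<close> by means of
  \<open>later\<close>, and \<open>only_zero\<close> then forces the set \<open>B\<close> of bad
  outcomes to be null.\<close>

lemma (in complete_filtered_prob_space) horizon_pos_step:
  assumes h0: "AE \<omega> in M. horizon_nonpos (offset n (Suc T)) (\<lambda>z. h z \<omega>) (\<lambda>_. 0)"
    and only_zero: "\<And>x. x \<in> adapted_processes F n T \<Longrightarrow>
        AE \<omega> in M. horizon_nonpos (offset n (Suc T)) (\<lambda>z. h z \<omega>) (history n x (Suc T) \<omega>) \<Longrightarrow>
        \<forall>t\<le>T. AE \<omega> in M. x t \<omega> = (\<lambda>_. 0)"
    and t: "t \<le> T" and dp: "dp_well_defined M F n T h H t"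
    and later: "\<And>s. t < s \<Longrightarrow> s \<le> T \<Longrightarrow> AE \<omega> in M. \<forall>y \<in> Rvec (n s) - {\<lambda>_. 0}.
        \<not> horizon_nonpos (offset n (Suc s)) (\<lambda>z. H s z \<omega>) (vappend (offset n s) (\<lambda>_. 0) y)"
  shows "AE \<omega> in M. \<forall>y \<in> Rvec (n t) - {\<lambda>_. 0}.
    \<not> horizon_nonpos (offset n (Suc t)) (\<lambda>z. H t z \<omega>) (vappend (offset n t) (\<lambda>_. 0) y)"
proof -
  have cond: "is_cond_integrand M (F s) (offset n s + n s) (h_tilde n T h H s) (H s)"
    if "t \<le> s" "s \<le> T" for s
    using dp that by (simp add: dp_well_defined_def offset_Suc)
  define Q :: "(nat \<Rightarrow> real) set" where "Q = - {\<lambda>_. 0}"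
  have Q: "Q \<in> sets borel" by (simp add: Q_def)
  obtain B y0 where B: "B \<in> sets (F t)" and y0: "y0 \<in> F t \<rightarrow>\<^sub>M borel_Rvec (n t)"
    and AE_B: "AE \<omega> in M. (\<exists>y\<in>Rvec (n t) \<inter> Q. horizon_nonpos (offset n t + n t) (\<lambda>x. H t x \<omega>)
        (vappend (offset n t) (\<lambda>_. 0) y)) \<longrightarrow> \<omega> \<in> B"
    and y0_Q: "\<And>\<omega>. \<omega> \<in> B \<Longrightarrow> y0 \<omega> \<in> Q"
    and y0_hn: "AE \<omega> in M. \<omega> \<in> B \<longrightarrow> horizon_nonpos (offset n t + n t) (\<lambda>x. h_tilde n T h H t x \<omega>)
        (vappend (offset n t) (\<lambda>_. 0) (y0 \<omega>))"
    by (rule stage_selection[OF prob_space_axioms subalg[OF t] cond[OF order_refl t] zero_measurable Q]) blast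
  \<comment> \<open>The invariant concerns the integrand before conditioning at stage
    \<open>s\<close>, which for \<open>s = T\<close> is \<open>h\<close> itself.\<close>
  have "\<exists>x. (\<forall>r\<le>s. x r \<in> F r \<rightarrow>\<^sub>M borel_Rvec (n r)) \<and> (\<forall>r<t. x r = (\<lambda>_ _. 0)) \<and> x t = y0 \<and>
      (AE \<omega> in M. \<omega> \<in> B \<longrightarrow>
        horizon_nonpos (offset n (Suc s)) (\<lambda>z. h_tilde n T h H s z \<omega>) (history n x (Suc s) \<omega>))"
    if "t \<le> s" "s \<le> T" for s
    using that
  proof (induction s rule: dec_induct)
    case base
    define x where "x r = (if r = t then y0 else (\<lambda>_ _. 0))" for r
    have x: "x t = y0" "\<And>r. r < t \<Longrightarrow> x r = (\<lambda>_ _. 0)" by (auto simp: x_def)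
    have "history n x t \<omega> = (\<lambda>_. 0)" for \<omega> by (rule history_zero) (simp add: x)
    moreover have "x r \<in> F r \<rightarrow>\<^sub>M borel_Rvec (n r)" for r
      using y0 by (simp add: x_def zero_measurable)
    ultimately show ?case using y0_hn by (intro exI[of _ x]) (simp add: x offset_Suc)
  next
    case (step s)
    have "s \<le> T" "t < Suc s" using step by simp_all
    from step.IH[OF \<open>s \<le> T\<close>] obtain x where ind:
      "(\<forall>r\<le>s. x r \<in> F r \<rightarrow>\<^sub>M borel_Rvec (n r)) \<and> (\<forall>r<t. x r = (\<lambda>_ _. 0)) \<and> x t = y0 \<and>
      (AE \<omega> in M. \<omega> \<in> B \<longrightarrow>
        horizon_nonpos (offset n (Suc s)) (\<lambda>z. h_tilde n T h H s z \<omega>) (history n x (Suc s) \<omega>))" ..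
    then have x: "\<And>r. r \<le> s \<Longrightarrow> x r \<in> F r \<rightarrow>\<^sub>M borel_Rvec (n r)" "\<And>r. r < t \<Longrightarrow> x r = (\<lambda>_ _. 0)" "x t = y0"
      and hn: "AE \<omega> in M. \<omega> \<in> B \<longrightarrow>
        horizon_nonpos (offset n (Suc s)) (\<lambda>z. h_tilde n T h H s z \<omega>) (history n x (Suc s) \<omega>)"
      by (simp_all del: history.simps)
    define w where "w = history n x (Suc s)"
    have w: "w \<in> F (Suc s) \<rightarrow>\<^sub>M borel_Rvec (offset n (Suc s))"
      unfolding w_def
    proof (rule history_measurable)
      fix r assume "r < Suc s"
      then have "subalgebra (F (Suc s)) (F r)"
        using step.prems filtration_mono[of r "Suc s"] subalg[of r] subalg[of "Suc s"]
        by (auto simp: subalgebra_def)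
      then show "x r \<in> F (Suc s) \<rightarrow>\<^sub>M borel_Rvec (n r)"
        using x(1)[of r] \<open>r < Suc s\<close> by (auto intro: measurable_from_subalg)
    qed
    have w_Rvec: "w \<omega> \<in> Rvec (offset n (Suc s))" if "\<omega> \<in> space M" for \<omega>
      using w that subalg[OF step.prems] by (auto simp: measurable_borel_Rvec_iff subalgebra_def)
    \<comment> \<open>The continuation may be zero, hence \<open>UNIV\<close>: on \<open>B\<close>
      the process is already nonzero through \<open>y0\<close>.\<close>
    obtain B' y where y: "y \<in> F (Suc s) \<rightarrow>\<^sub>M borel_Rvec (n (Suc s))"
      and AE_B': "AE \<omega> in M. (\<exists>y\<in>Rvec (n (Suc s)) \<inter> UNIV. horizon_nonpos (offset n (Suc s) + n (Suc s))
        (\<lambda>x. H (Suc s) x \<omega>) (vappend (offset n (Suc s)) (w \<omega>) y)) \<longrightarrow> \<omega> \<in> B'"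
      and y_hn: "AE \<omega> in M. \<omega> \<in> B' \<longrightarrow> horizon_nonpos (offset n (Suc s) + n (Suc s))
        (\<lambda>x. h_tilde n T h H (Suc s) x \<omega>) (vappend (offset n (Suc s)) (w \<omega>) (y \<omega>))"
      by (rule stage_selection[OF prob_space_axioms subalg[OF step.prems] cond w, of UNIV])
        (use step in auto)
    define x' where "x' = x(Suc s := y)"
    have hist: "history n x' (Suc s) \<omega> = w \<omega>" for \<omega>
      unfolding w_def by (rule history_cong) (simp add: x'_def)
    have "AE \<omega> in M. \<omega> \<in> B \<longrightarrow> horizon_nonpos (offset n (Suc (Suc s)))
        (\<lambda>z. h_tilde n T h H (Suc s) z \<omega>) (history n x' (Suc (Suc s)) \<omega>)"
      using hn AE_B' y_hn later[OF \<open>t < Suc s\<close> step.prems] AE_space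
    proof eventually_elim
      case (elim \<omega>)
      show ?case
      proof
        assume "\<omega> \<in> B"
        with elim(1) have "horizon_nonpos (offset n (Suc s))
            (\<lambda>x. INF y\<in>Rvec (n (Suc s)). H (Suc s) (vappend (offset n (Suc s)) x y) \<omega>) (w \<omega>)"
          using step by (simp add: w_def h_tilde_def)
        \<comment> \<open>This continuation is found for each outcome separately. Its existence puts
          almost every outcome of \<open>B\<close> into \<open>B'\<close>, where the measurable
          \<open>y\<close> takes its place.\<close>
        then have "\<exists>u\<in>Rvec (n (Suc s)). horizon_nonpos (offset n (Suc s) + n (Suc s)) (\<lambda>x. H (Suc s) x \<omega>)
            (vappend (offset n (Suc s)) (w \<omega>) u)"
          using elim(4) w_Rvec[OF elim(5)] step
          by (intro horizon_nonpos_inf_projection) (auto simp: offset_Suc)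
        then show "horizon_nonpos (offset n (Suc (Suc s)))
            (\<lambda>z. h_tilde n T h H (Suc s) z \<omega>) (history n x' (Suc (Suc s)) \<omega>)"
          using elim(2,3) by (simp only: history.simps(2)[of n x' "Suc s"] hist offset_Suc[of n "Suc s"])
            (auto simp: x'_def)
      qed
    qed
    moreover have "\<forall>r\<le>Suc s. x' r \<in> F r \<rightarrow>\<^sub>M borel_Rvec (n r)"
      using x(1) y by (simp add: x'_def le_Suc_eq)
    moreover have "\<forall>r<t. x' r = (\<lambda>_ _. 0)" "x' t = y0"
      using x(2,3) \<open>t < Suc s\<close> by (simp_all add: x'_def)
    ultimately show ?case by (intro exI[of _ x'] conjI)
  qed
  from this[OF t order_refl] obtain x where ind:
    "(\<forall>r\<le>T. x r \<in> F r \<rightarrow>\<^sub>M borel_Rvec (n r)) \<and> (\<forall>r<t. x r = (\<lambda>_ _. 0)) \<and> x t = y0 \<and>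
    (AE \<omega> in M. \<omega> \<in> B \<longrightarrow>
      horizon_nonpos (offset n (Suc T)) (\<lambda>z. h_tilde n T h H T z \<omega>) (history n x (Suc T) \<omega>))" ..
  then have x: "\<And>r. r \<le> T \<Longrightarrow> x r \<in> F r \<rightarrow>\<^sub>M borel_Rvec (n r)" "\<And>r. r < t \<Longrightarrow> x r = (\<lambda>_ _. 0)" "x t = y0"
    and hn: "AE \<omega> in M. \<omega> \<in> B \<longrightarrow>
      horizon_nonpos (offset n (Suc T)) (\<lambda>z. h z \<omega>) (history n x (Suc T) \<omega>)"
    by (simp_all add: h_tilde_def del: history.simps)
  \<comment> \<open>Off \<open>B\<close> the process is cut to 0 and compared with \<open>h\<close> directly: there \<open>H t\<close> may be identically \<open>\<infinity>\<close>.\<close>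
  define x' where "x' r \<omega> = (if \<omega> \<in> B then x r \<omega> else (\<lambda>_. 0))" for r \<omega>
  have "x' \<in> adapted_processes F n T"
    unfolding adapted_processes_def
  proof (intro CollectI allI impI)
    fix r assume r: "r \<le> T"
    show "x' r \<in> F r \<rightarrow>\<^sub>M borel_Rvec (n r)"
    \<comment> \<open>From stage \<open>t\<close> on, \<open>B\<close> belongs to
      \<open>F r\<close>; before that the process is zero and cutting it changes nothing.\<close>
    proof (cases "r < t")
      case True
      then have "x' r = (\<lambda>_ _. 0)" using x(2) by (auto simp: x'_def)
      then show ?thesis by (simp add: zero_measurable)
    next
      case False
      then have "B \<in> sets (F r)" using B filtration_mono[of t r] r by auto
      then show ?thesis unfolding x'_def
        by (intro measurable_If_set x(1) r zero_measurable) (simp add: sets.Int_space_eq2)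
    qed
  qed
  moreover have "AE \<omega> in M. horizon_nonpos (offset n (Suc T)) (\<lambda>z. h z \<omega>) (history n x' (Suc T) \<omega>)"
    using hn h0
  proof eventually_elim
    case (elim \<omega>)
    have "history n x' (Suc T) \<omega> = (if \<omega> \<in> B then history n x (Suc T) \<omega> else (\<lambda>_. 0))"
      using history_cong[of "Suc T" x' \<omega> x n] history_zero[of "Suc T" x' \<omega> n]
      by (simp add: x'_def del: history.simps)
    then show ?case using elim by (simp del: history.simps)
  qed
  ultimately have "AE \<omega> in M. x' t \<omega> = (\<lambda>_. 0)" using only_zero t by blast
  then show ?thesis
    using AE_B
  proof eventually_elim
    case (elim \<omega>)
    \<comment> \<open>On \<open>B\<close> the value of \<open>x' t\<close> is that of
      \<open>y0\<close>, which avoids the zero vector.\<close>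
    have "\<omega> \<notin> B" using elim(1) y0_Q[of \<omega>] x(3) by (auto simp: x'_def Q_def split: if_splits)
    then show ?case using elim(2) by (auto simp: Q_def offset_Suc)
  qed
qed

theorem lemma5:
  fixes M :: "'a measure"
    and F :: "nat \<Rightarrow> 'a measure"
    and T :: nat
    and n :: "nat \<Rightarrow> nat"
    and h :: "(nat \<Rightarrow> real) \<Rightarrow> 'a \<Rightarrow> ereal"
    and m :: "'a \<Rightarrow> real"
    and H :: "nat \<Rightarrow> (nat \<Rightarrow> real) \<Rightarrow> 'a \<Rightarrow> ereal"
    and t :: nat
  assumes "complete_filtered_prob_space M F T"
    and "normal_integrand M (offset n (Suc T)) h"
    and "bounded_below_by M (offset n (Suc T)) h m"
    and "{x \<in> adapted_processes F n T.
            AE \<omega> in M. horizon (offset n (Suc T)) (\<lambda>z. h z \<omega>) (history n x (Suc T) \<omega>) \<le> 0}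
         = {x \<in> adapted_processes F n T. \<forall>t\<le>T. AE \<omega> in M. x t \<omega> = (\<lambda>_. 0)}"
    and "t \<le> T"
    and "dp_well_defined M F n T h H t"
  shows "AE \<omega> in M. \<forall>y \<in> Rvec (n t) - {\<lambda>_. 0}.
           0 < horizon (offset n (Suc t)) (\<lambda>z. H t z \<omega>) (vappend (offset n t) (\<lambda>_. 0) y)"
proof -
  interpret complete_filtered_prob_space M F T by fact
  note trivial = assms(4)[unfolded horizon_le_0_iff]
  \<comment> \<open>The zero process lies in the right-hand set, so the assumed equality yields a
    nonpositive horizon of \<open>h\<close> at 0. This excludes that \<open>h\<close> is identically
    infinite with positive probability.\<close>
  have "(\<lambda>_ _ _. 0) \<in> adapted_processes F n T"
    by (auto simp: adapted_processes_def intro: zero_measurable)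
  then have "AE \<omega> in M. horizon_nonpos (offset n (Suc T)) (\<lambda>z. h z \<omega>) (history n (\<lambda>_ _ _. 0) (Suc T) \<omega>)"
    using equalityD2[OF trivial] by (auto simp del: history.simps)
  then have h0: "AE \<omega> in M. horizon_nonpos (offset n (Suc T)) (\<lambda>z. h z \<omega>) (\<lambda>_. 0)"
    by (simp add: history_zero del: history.simps)
  have only_zero: "\<forall>t\<le>T. AE \<omega> in M. x t \<omega> = (\<lambda>_. 0)"
    if "x \<in> adapted_processes F n T"
      "AE \<omega> in M. horizon_nonpos (offset n (Suc T)) (\<lambda>z. h z \<omega>) (history n x (Suc T) \<omega>)" for x
  proof -
    have "x \<in> {x \<in> adapted_processes F n T. \<forall>t\<le>T. AE \<omega> in M. x t \<omega> = (\<lambda>_. 0)}"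
      unfolding trivial[symmetric] using that by (intro CollectI conjI)
    then show ?thesis unfolding mem_Collect_eq ..
  qed
  have "AE \<omega> in M. \<forall>y \<in> Rvec (n s) - {\<lambda>_. 0}.
      \<not> horizon_nonpos (offset n (Suc s)) (\<lambda>z. H s z \<omega>) (vappend (offset n s) (\<lambda>_. 0) y)"
    if "t \<le> s" "s \<le> T" for s
    using that
  \<comment> \<open>Induction on \<open>T - s\<close> runs backwards in time; well-definedness at
    \<open>t\<close> covers every later \<open>s\<close>.\<close>
  proof (induction "T - s" arbitrary: s rule: less_induct)
    case less
    have dp: "dp_well_defined M F n T h H s"
      using assms(6) less.prems by (simp add: dp_well_defined_def)
    show ?case
      by (rule horizon_pos_step[OF h0 only_zero less.prems(2) dp less.hyps]) (use less.prems in auto)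
  qed
  then show ?thesis using assms(5) by (simp add: horizon_pos_iff)
qed

end
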